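(* Let $T$ be a hyperbolic automorphism of $\mathbb T^2=\mathbb R^2/\mathbb Z^2$ given by a primitive matrix $M_T=\begin{pmatrix} a & b \\ c & d \end{pmatrix}\in GL(2,\mathbb Z)$ with $r=\operatorname{Tr}M_T>0$, $\sigma=\det M_T$, $D=r^2-4\sigma$, $\lambda=\frac{r+\sqrt D}2$. Let $m=\min\{|f_T(x,y)|:(x,y)\in\mathbb Z^2\setminus\{(0,0)\}\}$ and let $(x^{(j)},y^{(j)})$, $1\le j\le s$, be the basis solutions of $f_T(x,y)=\pm m$. Then each minimal arithmetic coding of $T$ is of the form $$\varphi^{\pm}_{k,j}(\varepsilon)=\Big(\sum_{n=-\infty}^\infty\varepsilon_n\lambda^{-n}\Big)\begin{pmatrix} \pm\xi_j\lambda^k \\ \pm\eta_j\lambda^k \end{pmatrix}\bmod\mathbb Z^2$$ for some $k\in\mathbb Z$, some $j\in\{1,\dots,s\}$ and some choice of sign (the same in both coordinates). Here $(\xi_j,\eta_j)$ is the homoclinic point given by the solution $(x^{(j)},y^{(j)})$ as follows: $$\xi_j=\frac{y^{(j)}+n^{(j)}\lambda}{\sqrt D},\qquad \eta_j=\frac{x^{(j)}+k^{(j)}\lambda}{\sqrt D},\qquad \begin{pmatrix} n^{(j)} \\ k^{(j)} \end{pmatrix}=-\det M_T\cdot M_T\begin{pmatrix} y^{(j)} \\ x^{(j)} \end{pmatrix}.$$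
   Context: $M\in GL(2,\mathbb Z)$ is primitive if there is no $K\in GL(2,\mathbb Z)$ and $n\ge2$ with $M=K^n$. The form associated with $T$ is $f_T(x,y)=bx^2-(a-d)xy-cy^2$. Basis solutions: a finite collection of integral solutions $(x^{(j)},y^{(j)})$, $1\le j\le s$, of $f_T(x,y)=\pm m$ such that every integral solution $(x,y)$ of $f_T(x,y)=\pm m$ is of the form $(x,y)=\pm(x^{(j)},y^{(j)})M_T^{n}$ (row vector times matrix) for some $n\in\mathbb Z$ and some $j$, and $(x^{(i)},y^{(i)})\ne\pm(x^{(j)},y^{(j)})M_T^n$ for $i\ne j$ and all $n\in\mathbb Z$. Such a collection exists. A point $x\in\mathbb T^2$ is homoclinic (to zero) if $T^nx\to0$ as $n\to\pm\infty$; it is written in coordinates of $\mathbb R^2$ as its unique lift on the $\lambda$-eigenline of $M_T$. Symbolic compactum $\mathfrak X$: if $\sigma=-1$, the set of two-sided sequences with $\varepsilon_n\in\{0,\dots,r\}$ and $\varepsilon_n=r\Rightarrow\varepsilon_{n+1}=0$; if $\sigma=+1$, the set of two-sided sequences with $\varepsilon_n\in\{0,\dots,r-1\}$ containing no block $(r-1)(r-2)^j(r-1)$, $j\ge0$. An arithmetic coding of $T$ is a map $\varphi_{\mathbf t}:\mathfrak X\to\mathbb T^2$, $\varphi_{\mathbf t}(\varepsilon)=\lim_{N\to\infty}\big(\sum_{n=-N}^N\varepsilon_n\lambda^{-n}\big)\mathbf t\bmod\mathbb Z^2$, with $\mathbf t\neq0$ homoclinic (in coordinates of $\mathbb R^2$);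 two-sided series modulo $\mathbb Z^2$ are understood as such limits. Each arithmetic coding is $K$-to-$1$ almost everywhere for some natural $K$ (Lebesgue-almost every point has exactly $K$ preimages). A minimal arithmetic coding is one with the smallest possible $K$.
   Formalization: The printed statement has a sign slip (it fails for M_T with rows (-2,-3), (3,5)); y^(j) is replaced by -y^(j) in the formulas for ξ_j, η_j and (n^(j),k^(j)), i.e. the column (y^(j),x^(j)) becomes (-y^(j),x^(j)). *)

theory Defs
  imports "HOL-Analysis.Analysis"
begin

definition lattice_rel :: "real^2 \<Rightarrow> real^2 \<Rightarrow> bool" where
  "lattice_rel x y \<longleftrightarrow> (\<forall>i. x $ i - y $ i \<in> \<int>)"

lemma equivp_lattice_rel: "equivp lattice_rel"
proof (rule equivpI)
  show "reflp lattice_rel"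
    by (auto simp: lattice_rel_def intro: reflpI)
  show "symp lattice_rel"
    unfolding lattice_rel_def by (rule sympI) (metis Ints_minus minus_diff_eq)
  show "transp lattice_rel"
  proof (rule transpI, unfold lattice_rel_def, intro allI)
    fix x y z :: "real^2" and i
    assume a: "\<forall>i. x $ i - y $ i \<in> \<int>" and b: "\<forall>i. y $ i - z $ i \<in> \<int>"
    have "(x $ i - y $ i) + (y $ i - z $ i) \<in> \<int>"
      using a b by (blast intro: Ints_add)
    then show "x $ i - z $ i \<in> \<int>" by simp
  qed
qed

quotient_type torus = "real^2" / lattice_rel
  morphisms rep_torus torus_of
  by (rule equivp_lattice_rel)

instantiation torus :: topological_space
begin

(* the quotient topology *)
definition open_torus :: "torus set \<Rightarrow> bool" where
  "open_torus U \<longleftrightarrow> open (torus_of -` U)"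

instance
proof
  show "open (UNIV :: torus set)"
    by (simp add: open_torus_def)
  show "open (U \<inter> V)" if "open U" "open V" for U V :: "torus set"
    using that by (simp add: open_torus_def open_Int vimage_Int)
  show "open (\<Union>\<U>)" if "\<forall>U\<in>\<U>. open U" for \<U> :: "torus set set"
    using that by (auto simp: open_torus_def vimage_Union)
qed

end

(* Lebesgue measure on the torus, transported from the fundamental domain [0,1)^2 *)
definition torus_lebesgue :: "torus measure" where
  "torus_lebesgue =
     distr (restrict_space lborel {x :: real^2. \<forall>i. 0 \<le> x $ i \<and> x $ i < 1}) borel torus_of"

abbreviation real_matrix :: "int^2^2 \<Rightarrow> real^2^2" where
  "real_matrix M \<equiv> map_matrix real_of_int M"

lift_definition torus_map :: "int^2^2 \<Rightarrow> torus \<Rightarrow> torus" is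
  "\<lambda>M x. real_matrix M *v x"
proof -
  fix M :: "int^2^2" and x y :: "real^2"
  assume xy: "lattice_rel x y"
  show "lattice_rel (real_matrix M *v x) (real_matrix M *v y)"
    unfolding lattice_rel_def
  proof
    fix i
    have "(real_matrix M *v x) $ i - (real_matrix M *v y) $ i
        = (\<Sum>j\<in>UNIV. real_of_int (M $ i $ j) * (x $ j - y $ j))"
      by (simp add: matrix_vector_mult_def sum_subtractf right_diff_distrib)
    also have "\<dots> \<in> \<int>"
      using xy by (intro Ints_sum Ints_mult) (auto simp: lattice_rel_def)
    finally show "(real_matrix M *v x) $ i - (real_matrix M *v y) $ i \<in> \<int>" .
  qed
qed

(* Matrix powers; the library's power operation on vectors of vectors is componentwise.
   Over the integers, invertible M means M : GL(2,Z). *)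
definition matpow :: "int^2^2 \<Rightarrow> nat \<Rightarrow> int^2^2" where
  "matpow M n = ((\<lambda>A. M ** A) ^^ n) (mat 1)"

definition matpowi :: "int^2^2 \<Rightarrow> int \<Rightarrow> int^2^2" where
  "matpowi M n = (if 0 \<le> n then matpow M (nat n) else matpow (matrix_inv M) (nat (- n)))"

definition primitive_matrix :: "int^2^2 \<Rightarrow> bool" where
  "primitive_matrix M \<longleftrightarrow> \<not> (\<exists>K n. invertible K \<and> 2 \<le> n \<and> M = matpow K n)"

definition hyperbolic_matrix :: "int^2^2 \<Rightarrow> bool" where
  "hyperbolic_matrix M \<longleftrightarrow>
     (\<forall>(z::complex) (v::complex^2). v \<noteq> 0 \<longrightarrow> map_matrix of_int M *v v = z *s v \<longrightarrow> cmod z \<noteq> 1)"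

definition discr :: "int^2^2 \<Rightarrow> int" where
  "discr M = (trace M)^2 - 4 * det M"

definition lam :: "int^2^2 \<Rightarrow> real" where
  "lam M = (of_int (trace M) + sqrt (of_int (discr M))) / 2"

definition qform :: "int^2^2 \<Rightarrow> int^2 \<Rightarrow> int" where
  "qform M v = M$1$2 * (v$1)^2 - (M$1$1 - M$2$2) * v$1 * v$2 - M$2$1 * (v$2)^2"

definition form_min :: "int^2^2 \<Rightarrow> int" where
  "form_min M = int (LEAST k. \<exists>v. v \<noteq> 0 \<and> k = nat \<bar>qform M v\<bar>)"

definition is_solution :: "int^2^2 \<Rightarrow> int^2 \<Rightarrow> bool" where
  "is_solution M v \<longleftrightarrow> qform M v = form_min M \<or> qform M v = - form_min M"

definition basis_solutions :: "int^2^2 \<Rightarrow> nat \<Rightarrow> (nat \<Rightarrow> int^2) \<Rightarrow> bool" where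
  "basis_solutions M s w \<longleftrightarrow>
     (\<forall>j\<in>{1..s}. is_solution M (w j)) \<and>
     (\<forall>v. is_solution M v \<longrightarrow>
        (\<exists>j\<in>{1..s}. \<exists>n::int. v = w j v* matpowi M n \<or> v = - (w j v* matpowi M n))) \<and>
     (\<forall>i\<in>{1..s}. \<forall>j\<in>{1..s}. i \<noteq> j \<longrightarrow>
        (\<forall>n::int. w i \<noteq> w j v* matpowi M n \<and> w i \<noteq> - (w j v* matpowi M n)))"

definition homoclinic :: "int^2^2 \<Rightarrow> torus \<Rightarrow> bool" where
  "homoclinic M p \<longleftrightarrow>
     (\<lambda>n. (torus_map M ^^ n) p) \<longlonglongrightarrow> torus_of 0 \<and>
     (\<lambda>n. (inv (torus_map M) ^^ n) p) \<longlonglongrightarrow> torus_of 0"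

(* t : R^2 is the lift on the lambda-eigenline of a nonzero homoclinic point *)
definition homoclinic_lift :: "int^2^2 \<Rightarrow> real^2 \<Rightarrow> bool" where
  "homoclinic_lift M t \<longleftrightarrow>
     t \<noteq> 0 \<and> real_matrix M *v t = lam M *\<^sub>R t \<and> homoclinic M (torus_of t)"

definition compactum :: "int^2^2 \<Rightarrow> (int \<Rightarrow> int) set" where
  "compactum M =
     (let r = trace M in
      if det M = -1 then
        {\<epsilon>. \<forall>n. \<epsilon> n \<in> {0..r} \<and> (\<epsilon> n = r \<longrightarrow> \<epsilon> (n + 1) = 0)}
      else
        {\<epsilon>. (\<forall>n. \<epsilon> n \<in> {0..r - 1}) \<and>
            \<not> (\<exists>(n::int) (j::nat). \<epsilon> n = r - 1 \<and>
                 (\<forall>i\<in>{1..int j}. \<epsilon> (n + i) = r - 2) \<and> \<epsilon> (n + int j + 1) = r - 1)})"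

definition is_coding_by :: "int^2^2 \<Rightarrow> real^2 \<Rightarrow> ((int \<Rightarrow> int) \<Rightarrow> torus) \<Rightarrow> bool" where
  "is_coding_by M t \<phi> \<longleftrightarrow>
     (\<forall>\<epsilon>\<in>compactum M.
        (\<lambda>N. torus_of ((\<Sum>n = - int N..int N. of_int (\<epsilon> n) * lam M powi (- n)) *\<^sub>R t))
          \<longlonglongrightarrow> \<phi> \<epsilon>)"

definition arithmetic_coding :: "int^2^2 \<Rightarrow> ((int \<Rightarrow> int) \<Rightarrow> torus) \<Rightarrow> bool" where
  "arithmetic_coding M \<phi> \<longleftrightarrow> (\<exists>t. homoclinic_lift M t \<and> is_coding_by M t \<phi>)"

definition K_to_1_ae :: "int^2^2 \<Rightarrow> nat \<Rightarrow> ((int \<Rightarrow> int) \<Rightarrow> torus) \<Rightarrow> bool" where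
  "K_to_1_ae M K \<phi> \<longleftrightarrow> 1 \<le> K \<and>
     (AE p in torus_lebesgue.
        finite {\<epsilon> \<in> compactum M. \<phi> \<epsilon> = p} \<and> card {\<epsilon> \<in> compactum M. \<phi> \<epsilon> = p} = K)"

definition minimal_arithmetic_coding :: "int^2^2 \<Rightarrow> ((int \<Rightarrow> int) \<Rightarrow> torus) \<Rightarrow> bool" where
  "minimal_arithmetic_coding M \<phi> \<longleftrightarrow>
     arithmetic_coding M \<phi> \<and>
     (\<exists>K. K_to_1_ae M K \<phi> \<and>
        (\<forall>\<psi> L. arithmetic_coding M \<psi> \<longrightarrow> K_to_1_ae M L \<psi> \<longrightarrow> K \<le> L))"

(* The vector ((y + n lambda)/sqrt D, (x + k lambda)/sqrt D) with (n,k)^T = - det M M (y,x)^T.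
   With u = (y,x)^T, the coding by this vector is |det [u, M u]|-to-1, and
   |det [u, M u]| = |qform M (x,-y)|, whereas it is qform M (x,y) that is preserved up to sign
   by the row action (x,y) |-> (x,y) M.  So the homoclinic point belonging to a solution
   (x,y) of qform M (x,y) = +-m is homoclinic_vec M x (-y), not homoclinic_vec M x y. *)
definition homoclinic_vec :: "int^2^2 \<Rightarrow> int \<Rightarrow> int \<Rightarrow> real^2" where
  "homoclinic_vec M x y =
     (let nk = (- det M) *s (M *v vector [y, x]) in
      vector [(of_int y + of_int (nk $ 1) * lam M) / sqrt (of_int (discr M)),
              (of_int x + of_int (nk $ 2) * lam M) / sqrt (of_int (discr M))])"

end

theory Submission
  imports Defs
begin

text \<open>
  Homoclinic lifts are the projections \<open>Pu z\<close> of nonzero integer vectors \<open>z\<close> to the expanding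
  eigenline along the contracting one. Modulo \<open>\<int>\<^sup>2\<close> the coding by \<open>Pu z\<close> sends \<open>\<epsilon>\<close> to
  \<open>x Pu z - y Ps z\<close>, where \<open>x\<close> is the sum of \<open>\<epsilon>\<^sub>n \<lambda>\<^bsup>-n\<^esup>\<close> over \<open>n \<ge> 1\<close>, and \<open>y\<close> is the sum of
  \<open>\<epsilon>\<^sub>n \<lambda>'\<^bsup>-n\<^esup>\<close> over \<open>n \<le> 0\<close> with the conjugate \<open>\<lambda>'\<close> of \<open>\<lambda>\<close>. The pairs \<open>(x, y)\<close> fill an L-shaped
  domain that tiles the plane under the translations \<open>(\<alpha>, -\<alpha>')\<close> with \<open>\<alpha> \<in> \<int>[\<lambda>]\<close>, and the natural extension of the
  \<open>\<lambda>\<close>-expansion maps this domain to itself. So almost every point has exactly one code modulo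
  \<open>\<int>z + \<int>Mz\<close>, hence exactly \<open>\<bar>det (z, Mz)\<bar>\<close> codes modulo \<open>\<int>\<^sup>2\<close>. This determinant is, up to sign, the value
  of the quadratic form at the rotated vector, so minimal codings come from solutions of
  \<open>f(x, y) = \<plusminus>m\<close>, and the basis solutions account for all of these up to powers of \<open>\<lambda>\<close> and sign.
\<close>

subsection \<open>Tilings by an L-shaped domain\<close>

text \<open>The L-shape encodes the admissibility rule. The largest digit \<open>\<kappa>\<close> is
  the integer part of \<lambda>. While the digits read so far end in the beginning of a forbidden
  block, the past lies in the upper rectangle, at height \<lambda> - 1 or more, and there the future
  is confined to the smaller width \<lambda> - \<open>\<kappa>\<close>. The two rectangles have
  total area \<lambda> - \<lambda>', the covolume of the lattice of vectors (\<alpha>, -\<alpha>'),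
  so one can hope for a tiling and prove it by inequalities.

  Uniqueness of the representative in the domain works twice. It forces consecutive representatives
  of an orbit to be linked by a single digit, which produces a code; and it makes the coordinates of
  two codes of one point agree at all times.

  The obstacle is the boundary, because limits of digit sums satisfy only closed inequalities. It is
  avoided by requiring both coordinates to lie outside Z[\<lambda>]. This condition survives
  translation by Z[\<lambda>] and multiplication by the unit \<lambda>, and on the torus it fails
  only along the images of countably many lines.\<close>

definition L_domain :: "real \<Rightarrow> real \<Rightarrow> real \<Rightarrow> real \<Rightarrow> bool" where
  "L_domain \<nu> P x y \<longleftrightarrow> 0 \<le> x \<and> x < 1 \<and> 0 \<le> y \<and> y < P + 1 \<and> (y < P \<or> x < \<nu>)"

text \<open>Subtracting \<open>(1, -1)\<close> when \<open>y < P\<close> and \<open>(\<nu>, P)\<close> when \<open>y \<ge> P\<close> is a bijection of the strip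
  \<open>0 \<le> y < P + 1\<close>; the L-shaped domain consists of the points at which \<open>x\<close> is about to become
  negative.\<close>

lemma L_domain_translate_descend:
  fixes \<nu> P x y :: real
  assumes "0 < \<nu>" "\<nu> \<le> 1" "0 < P"
    and "0 \<le> x" "x < real k * \<nu>" "0 \<le> y" "y < P + 1"
  shows "\<exists>(m::int) (n::int). L_domain \<nu> P (x + (m * \<nu> + n)) (y + (m * P - n))"
  using assms(4-)
\<comment> \<open>\<open>k\<close> measures \<open>x\<close> in units of \<open>\<nu>\<close>:
  either subtraction lowers \<open>x\<close> by at least \<open>\<nu>\<close>, since
  \<open>\<nu> \<le> 1\<close>.\<close>
proof (induction k arbitrary: x y)
  case (Suc k)
  consider "y < P" "x < 1" | "y < P" "x \<ge> 1" | "y \<ge> P" "x < \<nu>" | "y \<ge> P" "x \<ge> \<nu>" by linarith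
  then show ?case
  proof cases
    case 2
    then have "\<exists>(m::int) (n::int). L_domain \<nu> P ((x - 1) + (m * \<nu> + n)) ((y + 1) + (m * P - n))"
      using Suc.prems assms(1-3) by (intro Suc.IH) (auto simp: algebra_simps)
    then obtain m n :: int where "L_domain \<nu> P ((x - 1) + (m * \<nu> + n)) ((y + 1) + (m * P - n))"
      by blast
    then show ?thesis by (intro exI[of _ m] exI[of _ "n - 1"]) (simp add: algebra_simps)
  next
    case 4
    then have "\<exists>(m::int) (n::int). L_domain \<nu> P ((x - \<nu>) + (m * \<nu> + n)) ((y - P) + (m * P - n))"
      using Suc.prems assms(1-3) by (intro Suc.IH) (auto simp: algebra_simps)
    then obtain m n :: int where "L_domain \<nu> P ((x - \<nu>) + (m * \<nu> + n)) ((y - P) + (m * P - n))"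
      by blast
    then show ?thesis by (intro exI[of _ "m - 1"] exI[of _ n]) (simp add: algebra_simps)
  qed (use Suc.prems assms in \<open>auto simp: L_domain_def intro!: exI[of _ "0::int"]\<close>)
qed auto

text \<open>The inverse bijection of the strip adds \<open>(\<nu>, P)\<close> when
  \<open>y < 1\<close> and \<open>(1, -1)\<close> otherwise, raising \<open>x\<close> by at least
  \<open>\<nu>\<close>. Once \<open>x\<close> is nonnegative, descending finishes.\<close>

lemma L_domain_translate_ascend:
  fixes \<nu> P x y :: real
  assumes "0 < \<nu>" "\<nu> \<le> 1" "0 < P"
    and "- (real k * \<nu>) \<le> x" "0 \<le> y" "y < P + 1"
  shows "\<exists>(m::int) (n::int). L_domain \<nu> P (x + (m * \<nu> + n)) (y + (m * P - n))"
proof -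
  have base: "\<exists>(m::int) (n::int). L_domain \<nu> P (x + (m * \<nu> + n)) (y + (m * P - n))"
    if "0 \<le> x" "0 \<le> y" "y < P + 1" for x y
  proof -
    obtain k where "x < real k * \<nu>"
      using ex_less_of_nat_mult[OF assms(1)] by blast
    then show ?thesis using L_domain_translate_descend[OF assms(1-3)] that by blast
  qed
  show ?thesis using assms(4-)
  proof (induction k arbitrary: x y)
    case (Suc k)
    consider "0 \<le> x" | "x < 0" "y < 1" | "x < 0" "y \<ge> 1" by linarith
    then show ?case
    proof cases
      case 1
      then show ?thesis using base Suc.prems by blast
    next
      case 2
      then have "\<exists>(m::int) (n::int). L_domain \<nu> P ((x + \<nu>) + (m * \<nu> + n)) ((y + P) + (m * P - n))"
        using Suc.prems assms(1-3) by (intro Suc.IH) (auto simp: algebra_simps)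
      then obtain m n :: int where "L_domain \<nu> P ((x + \<nu>) + (m * \<nu> + n)) ((y + P) + (m * P - n))"
        by blast
      then show ?thesis by (intro exI[of _ "m + 1"] exI[of _ n]) (simp add: algebra_simps)
    next
      case 3
      then have "\<exists>(m::int) (n::int). L_domain \<nu> P ((x + 1) + (m * \<nu> + n)) ((y - 1) + (m * P - n))"
        using Suc.prems assms(1-3) by (intro Suc.IH) (auto simp: algebra_simps)
      then obtain m n :: int where "L_domain \<nu> P ((x + 1) + (m * \<nu> + n)) ((y - 1) + (m * P - n))"
        by blast
      then show ?thesis by (intro exI[of _ m] exI[of _ "n + 1"]) (simp add: algebra_simps)
    qed
  qed (use base in simp)
qed

lemma L_domain_translate_exists:
  fixes \<nu> P x y :: real
  assumes "0 < \<nu>" "\<nu> \<le> 1" "0 < P"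
  obtains m n :: int where "L_domain \<nu> P (x + (m * \<nu> + n)) (y + (m * P - n))"
proof -
  \<comment> \<open>Subtracting \<open>i\<close> times \<open>(\<nu>, P)\<close> moves
    \<open>y\<close> into \<open>[0, P)\<close>, hence into the strip.\<close>
  define i where "i = \<lfloor>y / P\<rfloor>"
  have "i \<le> y / P" "y / P < i + 1" unfolding i_def by linarith+
  then have y: "0 \<le> y - i * P" "y - i * P < P + 1"
    using assms by (simp_all add: field_simps)
  obtain k where "- (x - i * \<nu>) < real k * \<nu>"
    using ex_less_of_nat_mult[OF assms(1)] by blast
  then have "- (real k * \<nu>) \<le> x - i * \<nu>" by simp
  from L_domain_translate_ascend[OF assms this y] obtain m n :: int where
    "L_domain \<nu> P ((x - i * \<nu>) + (m * \<nu> + n)) ((y - i * P) + (m * P - n))" by blast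
  then show ?thesis using that[of "m - i" n] by (simp add: algebra_simps)
qed

text \<open>For nonzero \<open>n\<close>, either \<open>m\<close> is 0 or has the sign of
  \<open>n\<close>, and \<open>x\<close> moves by at least 1, or the signs are opposite and
  \<open>y\<close> moves by at least \<open>P + 1\<close>; the domain has no room for either. A
  nonzero multiple of \<open>(\<nu>, P)\<close> would put the higher point at
  \<open>y \<ge> P\<close> and \<open>x \<ge> \<nu>\<close>, which is the notch.\<close>

lemma L_domain_translate_unique:
  fixes \<nu> P x y :: real and m n :: int
  assumes "0 < \<nu>" "\<nu> \<le> 1" "0 < P"
    and "L_domain \<nu> P x y" "L_domain \<nu> P (x + (m * \<nu> + n)) (y + (m * P - n))"
  shows "m = 0 \<and> n = 0"
proof -
  have pos: "m * \<nu> \<ge> \<nu> \<and> m * P \<ge> P" if "m \<ge> 1"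
    using that assms(1,3) by simp
  have neg: "m * \<nu> \<le> - \<nu> \<and> m * P \<le> - P" if "m \<le> -1"
  proof -
    have "real_of_int m \<le> -1" using that by linarith
    then show ?thesis
      using assms(1,3) mult_right_mono[of "real_of_int m" "-1" \<nu>] mult_right_mono[of "real_of_int m" "-1" P]
      by simp
  qed
  have n: "real_of_int n \<ge> 1 \<or> n = 0 \<or> real_of_int n \<le> -1" by linarith
  note L = assms(4,5)[unfolded L_domain_def]
  consider "m \<ge> 1" | "m \<le> -1" | "m = 0" by linarith
  then show ?thesis
  proof cases
    case 1
    show ?thesis using n pos[OF 1] assms(1-3) L by (elim disjE; auto)
  next
    case 2
    show ?thesis using n neg[OF 2] assms(1-3) L by (elim disjE; auto)
  next
    case 3
    show ?thesis using n 3 assms(1-3) L by (elim disjE; auto)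
  qed
qed

subsection \<open>Expansions in a quadratic unit\<close>

text \<open>The sum telescopes with remainder \<open>\<rho> ^ n * z n\<close>. This turns the
  coordinates of an orbit in the domain back into digit series.\<close>

lemma bounded_recursion_sums:
  fixes z c :: "nat \<Rightarrow> real"
  assumes rec: "\<And>k. z k = c k + \<rho> * z (Suc k)" and bd: "\<And>k. \<bar>z k\<bar> \<le> C" and "\<bar>\<rho>\<bar> < 1"
  shows "(\<lambda>k. c k * \<rho> ^ k) sums z 0"
proof -
  have partial: "(\<Sum>k<n. c k * \<rho> ^ k) = z 0 - \<rho> ^ n * z n" for n
  proof (induction n)
    case (Suc n)
    then show ?case using rec[of n] by (simp add: algebra_simps)
  qed simp
  have "(\<lambda>n. \<rho> ^ n * z n) \<longlonglongrightarrow> 0"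
  proof (rule Lim_null_comparison)
    show "(\<lambda>n. \<bar>\<rho>\<bar> ^ n * C) \<longlonglongrightarrow> 0"
      using tendsto_mult_right[OF LIMSEQ_power_zero[of "\<bar>\<rho>\<bar>"], of C] assms(3) by simp
    show "eventually (\<lambda>n. norm (\<rho> ^ n * z n) \<le> \<bar>\<rho>\<bar> ^ n * C) sequentially"
      by (simp add: abs_mult power_abs mult_left_mono bd)
  qed
  then have "(\<lambda>n. z 0 - \<rho> ^ n * z n) \<longlonglongrightarrow> z 0 - 0" by (intro tendsto_intros)
  then show ?thesis unfolding sums_def partial by simp
qed

text \<open>A slack of \<open>C\<close> at time \<open>k + n\<close> becomes
  \<open>\<rho> ^ n * C\<close> at time \<open>k\<close>, so any crude uniform bound improves to the
  exact one. The bounds may vary with \<open>k\<close> because they will follow the state of an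
  automaton.\<close>

lemma contracted_sequence_bounds:
  fixes z lo hi :: "nat \<Rightarrow> real"
  assumes step: "\<And>e k. 0 \<le> e \<Longrightarrow> lo (Suc k) - e \<le> z (Suc k) \<Longrightarrow> z (Suc k) \<le> hi (Suc k) + e \<Longrightarrow>
      lo k - \<rho> * e \<le> z k \<and> z k \<le> hi k + \<rho> * e"
    and bd: "\<And>k. lo k - C \<le> z k \<and> z k \<le> hi k + C" and "0 \<le> C" "0 \<le> \<rho>" "\<rho> < 1"
  shows "lo 0 \<le> z 0 \<and> z 0 \<le> hi 0"
proof -
  have "lo k - \<rho> ^ n * C \<le> z k \<and> z k \<le> hi k + \<rho> ^ n * C" for n k
  proof (induction n arbitrary: k)
    case (Suc n)
    show ?case using step[of "\<rho> ^ n * C" k] Suc[of "Suc k"] assms(3,4) by (simp add: mult.assoc)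
  qed (use bd in simp)
  then have *: "lo 0 - \<rho> ^ n * C \<le> z 0" "z 0 \<le> hi 0 + \<rho> ^ n * C" for n by blast+
  have lim: "(\<lambda>n. \<rho> ^ n * C) \<longlonglongrightarrow> 0 * C"
    using assms by (intro tendsto_intros LIMSEQ_power_zero) auto
  have "lo 0 - 0 * C \<le> z 0"
    by (rule LIMSEQ_le_const2[OF tendsto_diff[OF tendsto_const lim]]) (use * in auto)
  moreover have "z 0 \<le> hi 0 + 0 * C"
    by (rule LIMSEQ_le_const[OF tendsto_add[OF tendsto_const lim]]) (use * in auto)
  ultimately show ?thesis by simp
qed

locale quadratic_unit =
  fixes r \<sigma> :: int
  assumes sigma_cases: "\<sigma> = 1 \<or> \<sigma> = -1" and r_pos: "0 < r" and r_ge_3: "\<sigma> = 1 \<Longrightarrow> 3 \<le> r"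
begin

definition l :: real where "l = (r + sqrt (of_int (r\<^sup>2 - 4 * \<sigma>))) / 2"
definition lc :: real where "lc = (r - sqrt (of_int (r\<^sup>2 - 4 * \<sigma>))) / 2"

text \<open>The domain consists of \<open>y0 < y < l - 1\<close> over \<open>0 < x < 1\<close> and \<open>l - 1 \<le> y < l\<close> over \<open>0 < x < l - \<kappa>\<close>.\<close>

definition \<kappa> :: int where "\<kappa> = (if \<sigma> = 1 then r - 1 else r)"
definition y0 :: int where "y0 = (if \<sigma> = 1 then 0 else -1)"

lemma discr_pos: "0 < r\<^sup>2 - 4 * \<sigma>"
proof (cases "\<sigma> = 1")
  case True
  then have "3\<^sup>2 \<le> r\<^sup>2" using r_ge_3 by (intro power_mono) auto
  then show ?thesis using True by simp
qed (use sigma_cases zero_le_power2[of r] in \<open>auto intro: add_nonneg_pos\<close>)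

lemma l_diff: "l - lc = sqrt (of_int (r\<^sup>2 - 4 * \<sigma>))"
  by (simp add: l_def lc_def field_simps)

lemma l_diff_pos: "0 < l - lc"
  unfolding l_diff using discr_pos by (simp only: real_sqrt_gt_0_iff of_int_0_less_iff)

lemma l_add: "l + lc = r"
  by (simp add: l_def lc_def field_simps)

lemma l_mult: "l * lc = \<sigma>"
proof -
  have "(l - lc)\<^sup>2 = of_int (r\<^sup>2 - 4 * \<sigma>)"
    unfolding l_diff using discr_pos by (intro real_sqrt_pow2) linarith
  moreover have "4 * (l * lc) = (l + lc)\<^sup>2 - (l - lc)\<^sup>2"
    by (simp add: power2_eq_square algebra_simps)
  ultimately show ?thesis by (simp add: l_add)
qed

lemma sigma_sq [simp]: "\<sigma> * \<sigma> = 1"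
  using sigma_cases by auto

lemma sigma_sq_real [simp]: "real_of_int \<sigma> * real_of_int \<sigma> = 1"
  using sigma_cases by auto

lemma l_sq: "l * l = r * l - \<sigma>" and lc_sq: "lc * lc = r * lc - \<sigma>"
  unfolding l_add[symmetric] l_mult[symmetric] by (simp_all add: algebra_simps)

lemma l_pos: "0 < l"
  using l_add l_diff_pos r_pos by linarith

lemma l_gt_1: "1 < l"
proof (cases "\<sigma> = 1")
  case True
  then show ?thesis using l_add l_diff_pos r_ge_3 by linarith
next
  case False
  then have "\<sigma> = -1" using sigma_cases by simp
  show ?thesis
  proof (rule ccontr)
    assume "\<not> 1 < l"
    moreover have "lc = r - l" using l_add by simp
    ultimately have "l * (r - l) \<ge> 0"
      using r_pos l_pos by (intro mult_nonneg_nonneg) linarith+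
    then show False using l_mult \<open>lc = r - l\<close> \<open>\<sigma> = -1\<close> by simp
  qed
qed

lemma inverse_l: "1 / l = \<sigma> * lc"
proof -
  have "l * (\<sigma> * lc) = 1" using l_mult by (simp add: mult.left_commute)
  then show ?thesis using l_pos by (simp add: field_simps)
qed

lemma abs_lc: "\<bar>lc\<bar> = 1 / l"
proof -
  have "\<bar>lc\<bar> = \<bar>1 / l\<bar>" unfolding inverse_l using sigma_cases by (auto simp: abs_mult)
  then show ?thesis using l_pos by simp
qed

lemma abs_lc_less_1: "\<bar>lc\<bar> < 1"
  using abs_lc l_gt_1 by simp

lemma lc_bounds:
  "\<sigma> = 1 \<Longrightarrow> 0 < lc \<and> lc < 1" "\<sigma> = -1 \<Longrightarrow> -1 < lc \<and> lc < 0"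
proof -
  have "\<sigma> = 1 \<Longrightarrow> lc = 1 / l" "\<sigma> = -1 \<Longrightarrow> lc = - (1 / l)" using inverse_l by auto
  then show "\<sigma> = 1 \<Longrightarrow> 0 < lc \<and> lc < 1" "\<sigma> = -1 \<Longrightarrow> -1 < lc \<and> lc < 0"
    using l_gt_1 by auto
qed

text \<open>All edges of the domain have abscissa or ordinate in Z[\<lambda>], so a generic point
  avoids them; it does so along its whole orbit because \<lambda> is a unit.\<close>

definition generic :: "real \<Rightarrow> bool" where
  "generic x \<longleftrightarrow> (\<forall>(p::int) (q::int). x \<noteq> p + q * l)"

lemma generic_neq: "generic x \<Longrightarrow> x \<noteq> of_int p + of_int q * l"
  by (simp add: generic_def)

lemma generic_add: "generic x \<Longrightarrow> generic (x + (of_int p + of_int q * l))"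
  unfolding generic_def
proof (intro allI notI)
  fix p' q' :: int
  assume *: "\<forall>(p::int) (q::int). x \<noteq> p + q * l" and "x + (p + q * l) = p' + q' * l"
  then have "x = of_int (p' - p) + of_int (q' - q) * l" by (simp add: algebra_simps)
  with * show False by blast
qed

lemma lc_eq: "lc = r - l"
  using l_add by simp

lemma generic_diff_conj: "generic x \<Longrightarrow> generic (x - (of_int p + of_int q * lc))"
  using generic_add[of x "- p - q * r" q] by (simp add: lc_eq algebra_simps)

lemma generic_lc_mult: "generic x \<Longrightarrow> generic (lc * x)"
  unfolding generic_def
proof (intro allI notI)
  fix p q :: int
  assume *: "\<forall>(p::int) (q::int). x \<noteq> p + q * l" and "lc * x = p + q * l"
  then have "\<sigma> * (l * lc * x) = \<sigma> * (l * (p + q * l))" by (simp add: mult.assoc)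
  also have "l * (p + q * l) = p * l + q * (l * l)" by (simp add: algebra_simps)
  finally have "\<sigma> * (\<sigma> * x) = \<sigma> * (p * l + q * (r * l - \<sigma>))"
    unfolding l_mult l_sq .
  also have "\<sigma> * (p * l + q * (r * l - \<sigma>)) = of_int (\<sigma> * (p + q * r)) * l - (\<sigma> * \<sigma>) * q"
    by (simp add: algebra_simps)
  finally have "x = of_int (- q) + of_int (\<sigma> * (p + q * r)) * l"
    by (simp add: mult.assoc[symmetric])
  with * show False by blast
qed

lemma generic_sigma_mult: "generic x \<Longrightarrow> generic (of_int \<sigma> * x)"
  unfolding generic_def
proof (intro allI notI)
  fix p q :: int
  assume *: "\<forall>(p::int) (q::int). x \<noteq> p + q * l" and "of_int \<sigma> * x = p + q * l"
  then have "x = \<sigma> * (p + q * l)" by (metis mult.assoc mult_1 sigma_sq_real)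
  then have "x = of_int (\<sigma> * p) + of_int (\<sigma> * q) * l"
    by (simp add: algebra_simps)
  with * show False by blast
qed

lemma generic_divide_l:
  assumes "generic x" shows "generic (x / l)"
proof -
  have "x / l = \<sigma> * (lc * x)" using inverse_l by (simp add: divide_inverse mult.assoc)
  then show ?thesis using generic_sigma_mult[OF generic_lc_mult[OF assms]] by simp
qed

lemma generic_l_mult: "generic x \<Longrightarrow> generic (l * x)"
  unfolding generic_def
proof (intro allI notI)
  fix p q :: int
  assume *: "\<forall>(p::int) (q::int). x \<noteq> p + q * l" and "l * x = p + q * l"
  then have "\<sigma> * lc * (l * x) = \<sigma> * lc * (p + q * l)" by simp
  moreover have "\<sigma> * lc * (l * x) = x" using inverse_l[symmetric] l_pos by simp
  moreover have "\<sigma> * lc * (p + q * l) = \<sigma> * (lc * p) + \<sigma> * (l * lc) * q"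
    by (simp add: algebra_simps)
  ultimately have "x = of_int (\<sigma> * p * r + q) + of_int (- (\<sigma> * p)) * l"
    unfolding l_mult by (simp add: lc_eq algebra_simps)
  with * show False by blast
qed


lemma generic_neq_of_int:
  "generic x \<Longrightarrow> x \<noteq> of_int p"
  using generic_neq[of x p 0] by simp

section \<open>The domain and the natural extension acting on it\<close>

definition domain :: "real \<Rightarrow> real \<Rightarrow> bool" where
  "domain x y \<longleftrightarrow> 0 < x \<and> x < 1 \<and> of_int y0 < y \<and> y < l \<and> (y < l - 1 \<or> x < l - \<kappa>)"

lemma parameters_plus:
  assumes "\<sigma> = 1"
  shows "\<kappa> = r - 1" "y0 = 0" "0 < lc" "lc < 1" "l + lc = r" "3 \<le> r" "l * lc = 1"
    "l * (l - \<kappa>) = l - 1"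
proof -
  show k: "\<kappa> = r - 1" unfolding \<kappa>_def using assms by simp
  show "y0 = 0" unfolding y0_def using assms by simp
  show "l * (l - \<kappa>) = l - 1" unfolding k using l_sq assms by (simp add: algebra_simps)
qed (use assms lc_bounds l_add r_ge_3 l_mult in auto)

lemma parameters_minus:
  assumes "\<sigma> \<noteq> 1"
  shows "\<kappa> = r" "y0 = -1" "-1 < lc" "lc < 0" "l + lc = r" "1 \<le> r" "l * lc = -1"
    "l * (l - \<kappa>) = 1"
proof -
  have s: "\<sigma> = -1" using assms sigma_cases by simp
  show k: "\<kappa> = r" unfolding \<kappa>_def using assms by simp
  show "y0 = -1" unfolding y0_def using assms by simp
  show "l * (l - \<kappa>) = 1" unfolding k using l_sq s by (simp add: algebra_simps)
  show "-1 < lc" "lc < 0" "l + lc = r" "1 \<le> r" "l * lc = -1"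
    using s lc_bounds l_add r_pos l_mult by auto
qed

text \<open>The vector \<open>(l - \<kappa>, \<kappa> - lc)\<close> is (\<alpha>, -\<alpha>') for
  \<alpha> = \<open>l - \<kappa>\<close>, so together with (1, -1) it generates the whole lattice of
  Z[\<lambda>]. The last equation matches the height of the L-shape with the range from
  \<open>y0\<close> to \<open>l\<close>.\<close>

lemma L_parameters: "0 < l - \<kappa>" "l - \<kappa> \<le> 1" "0 < \<kappa> - lc" "\<kappa> - lc + 1 = l - y0"
proof -
  have "0 < l - \<kappa> \<and> l - \<kappa> \<le> 1 \<and> 0 < \<kappa> - lc \<and> \<kappa> - lc + 1 = l - y0"
  proof (cases "\<sigma> = 1")
    case True
    note parameters_plus[OF True]
    then show ?thesis by simp
  next
    case False
    note parameters_minus[OF False]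
    then show ?thesis by simp
  qed
  then show "0 < l - \<kappa>" "l - \<kappa> \<le> 1" "0 < \<kappa> - lc" "\<kappa> - lc + 1 = l - y0" by blast+
qed

lemma domain_L_domain:
  "domain x y \<Longrightarrow> L_domain (l - \<kappa>) (\<kappa> - lc) x (y - of_int y0)"
  using L_parameters by (auto simp: domain_def L_domain_def)

lemma L_domain_domain:
  assumes "generic x" "generic y" "L_domain (l - \<kappa>) (\<kappa> - lc) x (y - of_int y0)"
  shows "domain x y"
  using assms(3) L_parameters(4) generic_neq_of_int[OF assms(1), of 0] generic_neq_of_int[OF assms(2), of y0]
  by (auto simp: domain_def L_domain_def)

lemma domain_translate_exists:
  assumes "generic x" "generic y"
  obtains p q :: int where "domain (x + (p + q * l)) (y - (p + q * lc))"
proof -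
  obtain m n :: int where
    "L_domain (l - \<kappa>) (\<kappa> - lc) (x + (m * (l - \<kappa>) + n)) ((y - of_int y0) + (m * (\<kappa> - lc) - n))"
    by (rule L_domain_translate_exists[OF L_parameters(1-3)])
  \<comment> \<open>Change of basis from \<open>l - \<kappa>\<close>, 1 to 1, \<open>l\<close>:
    \<open>m * (l - \<kappa>) + n\<close> has coefficients \<open>n - \<kappa> * m\<close> and
    \<open>m\<close>.\<close>
  then have "L_domain (l - \<kappa>) (\<kappa> - lc) (x + (of_int (n - \<kappa> * m) + m * l))
      ((y - (of_int (n - \<kappa> * m) + m * lc)) - of_int y0)"
    by (simp add: algebra_simps)
  then have "domain (x + (of_int (n - \<kappa> * m) + m * l)) (y - (of_int (n - \<kappa> * m) + m * lc))"
    using assms by (intro L_domain_domain generic_add generic_diff_conj)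
  then show ?thesis using that by blast
qed

lemma domain_translate_unique:
  fixes p q :: int
  assumes "domain x y" "domain (x + (p + q * l)) (y - (p + q * lc))"
  shows "p = 0 \<and> q = 0"
proof -
  have "L_domain (l - \<kappa>) (\<kappa> - lc) (x + (q * (l - \<kappa>) + of_int (p + \<kappa> * q)))
      ((y - of_int y0) + (q * (\<kappa> - lc) - of_int (p + \<kappa> * q)))"
    using domain_L_domain[OF assms(2)] by (simp add: algebra_simps)
  from L_domain_translate_unique[OF L_parameters(1-3) domain_L_domain[OF assms(1)] this]
  show ?thesis by auto
qed

text \<open>For \<open>\<sigma> = 1\<close>, the narrow upper rectangle gives
  \<open>l * x < l - 1\<close> over \<open>y \<ge> l - 1\<close>; hence the digit there is at most
  \<open>r - 2\<close>, and the digit \<open>r - 2\<close> leads to the upper rectangle again. For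
  \<open>\<sigma> = -1\<close>, only the digit \<open>r\<close> leads to height \<open>l - 1\<close>
  or more, and it leaves an abscissa below \<open>l - r\<close>.\<close>

lemma domain_forward:
  assumes "domain x y" "generic x"
  shows "domain (l * x - \<lfloor>l * x\<rfloor>) (lc * y + \<lfloor>l * x\<rfloor>)"
proof -
  define d where "d = \<lfloor>l * x\<rfloor>"
  note dom = assms(1)[unfolded domain_def]
  have frac: "0 < l * x - d" "l * x - d < 1"
    using generic_neq_of_int[OF generic_l_mult[OF assms(2)], of d] unfolding d_def by linarith+
  have lx: "0 < l * x" "l * x < l" using dom l_pos by auto
  have lx\<nu>: "l * x < l * (l - \<kappa>) \<longleftrightarrow> x < l - \<kappa>" using l_pos by simp
  have d0: "0 \<le> d" unfolding d_def using lx by simp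
  \<comment> \<open>Naming the two products turns the final case analysis into linear
    arithmetic.\<close>
  define X Y where "X = l * x" and "Y = lc * y"
  show ?thesis
  proof (cases "\<sigma> = 1")
    case True
    note lc = parameters_plus[OF True]
    have lcy: "0 < lc * y" "lc * y < 1" "y < l - 1 \<Longrightarrow> lc * y < 1 - lc"
    proof -
      show "0 < lc * y" using lc dom by auto
      have "lc * y < lc * l" using lc dom by (intro mult_strict_left_mono) auto
      then show "lc * y < 1" using lc by (simp add: mult.commute)
      assume "y < l - 1"
      then have "lc * y < lc * (l - 1)" using lc by (intro mult_strict_left_mono) auto
      then show "lc * y < 1 - lc" using lc by (simp add: algebra_simps)
    qed
    have dr: "d \<le> r - 1" unfolding d_def using lx lc by linarith
    have y: "y < l - 1 \<or> l * x < l - 1" using dom unfolding lx\<nu>[symmetric] lc(8) by blast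
    consider "d = r - 1" | "d = r - 2" | "d \<le> r - 3" using dr by linarith
    then show ?thesis
      using frac lc(1-6) lcy lx d0 y
      unfolding domain_def d_def[symmetric] unfolding X_def[symmetric] Y_def[symmetric] by cases auto
  next
    case False
    note lc = parameters_minus[OF False]
    have lcy: "-1 < lc * y" "lc * y < -lc" "y < l - 1 \<Longrightarrow> lc * y > -1 - lc"
    proof -
      have "lc * y > lc * l" using lc dom by (intro mult_strict_left_mono_neg) auto
      then show "-1 < lc * y" using lc by (simp add: mult.commute)
      have "lc * y < lc * (-1)" using lc dom by (intro mult_strict_left_mono_neg) auto
      then show "lc * y < -lc" by simp
      assume "y < l - 1"
      then have "lc * y > lc * (l - 1)" using lc by (intro mult_strict_left_mono_neg) auto
      then show "lc * y > -1 - lc" using lc by (simp add: algebra_simps)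
    qed
    have dr: "d \<le> r" unfolding d_def using lx lc by linarith
    have y: "y < l - 1 \<or> l * x < 1" using dom unfolding lx\<nu>[symmetric] lc(8) by blast
    consider "d = 0" "d = r" | "d = 0" "d \<le> r - 1" | "1 \<le> d" "d = r" | "1 \<le> d" "d \<le> r - 1"
      using dr d0 by linarith
    then show ?thesis
      using frac lc(1-6) lcy lx d0 y
      unfolding domain_def d_def[symmetric] unfolding X_def[symmetric] Y_def[symmetric] by cases auto
  qed
qed

section \<open>Admissible digit sequences as paths of an automaton\<close>

definition admissible :: "(int \<Rightarrow> int) \<Rightarrow> bool" where
  "admissible \<epsilon> \<longleftrightarrow>
     (if \<sigma> = -1 then \<forall>n. \<epsilon> n \<in> {0..r} \<and> (\<epsilon> n = r \<longrightarrow> \<epsilon> (n + 1) = 0)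
      else (\<forall>n. \<epsilon> n \<in> {0..r - 1}) \<and>
            \<not> (\<exists>(n::int) (j::nat). \<epsilon> n = r - 1 \<and>
                 (\<forall>i\<in>{1..int j}. \<epsilon> (n + i) = r - 2) \<and> \<epsilon> (n + int j + 1) = r - 1))"

lemma admissible_bounds: "admissible \<epsilon> \<Longrightarrow> 0 \<le> \<epsilon> n \<and> \<epsilon> n \<le> r"
  unfolding admissible_def by (metis atLeastAtMost_iff diff_le_eq le_add_same_cancel1 order_trans zero_le_one)

text \<open>For \<open>\<sigma> = 1\<close>, the digit \<open>r - 1\<close> leaves \<open>x\<close>
  below \<open>l - r + 1\<close>. This bound is a fixed point of multiplying by \<open>l\<close> and
  subtracting \<open>r - 2\<close>, so digits \<open>r - 2\<close> preserve it, and a further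
  \<open>r - 1\<close> would make \<open>x\<close> negative. For \<open>\<sigma> = -1\<close>, the
  digit \<open>r\<close> leaves \<open>x\<close> below \<open>l - r = 1 / l\<close>, and the next
  digit is 0.\<close>

lemma greedy_digits_admissible:
  fixes x :: "int \<Rightarrow> real"
  assumes x: "\<And>n. 0 < x n \<and> x n < 1" and rec: "\<And>n. x (n + 1) = l * x n - \<epsilon> (n + 1)"
  shows "admissible \<epsilon>"
proof -
  have lx: "0 < l * x n \<and> l * x n < l" for n using x[of n] l_pos by simp
  have rec': "x n = l * x (n - 1) - \<epsilon> n" for n using rec[of "n - 1"] by simp
  have d: "-1 < real_of_int (\<epsilon> n)" and dl: "\<epsilon> n < l" for n
    using x[of n] lx[of "n - 1"] rec'[of n] by linarith+
  have d0: "0 \<le> \<epsilon> n" for n using d[of n] by linarith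
  show ?thesis
  proof (cases "\<sigma> = 1")
    case True
    have lc: "0 < lc" "lc < 1" "l + lc = r" "3 \<le> r"
      using lc_bounds True l_add r_ge_3 by auto
    have l\<nu>: "l * (l - r + 1) = l - 1" using l_sq True by (simp add: algebra_simps)
    have "\<epsilon> n \<le> r - 1" for n using dl[of n] lc by linarith
    moreover have False if "\<epsilon> n = r - 1" "\<forall>i\<in>{1..int j}. \<epsilon> (n + i) = r - 2" "\<epsilon> (n + int j + 1) = r - 1"
      for n :: int and j :: nat
    proof -
      have small: "l * x' < l - 1" if "x' < l - r + 1" for x'
        using mult_strict_left_mono[OF that l_pos] l\<nu> by simp
      have "i \<le> j \<Longrightarrow> x (n + int i) < l - r + 1" for i
      proof (induction i)
        case 0
        have "l * x (n - 1) < l" using x[of "n - 1"] l_pos by simp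
        then show ?case using rec'[of n] that(1) by simp
      next
        case (Suc i)
        then have "l * x (n + int i) < l - 1" by (intro small) simp
        moreover have "\<epsilon> (n + int i + 1) = r - 2" using that(2) Suc.prems by (simp add: add.assoc)
        ultimately show ?case using rec[of "n + int i"] by (simp add: algebra_simps)
      qed
      from small[OF this[of j]] have "l * x (n + int j) < l - 1" by simp
      then show False using rec[of "n + int j"] x[of "n + int j + 1"] that(3) lc by simp
    qed
    ultimately show ?thesis unfolding admissible_def using d0 True by auto
  next
    case False
    then have s: "\<sigma> = -1" using sigma_cases by simp
    have lc: "-1 < lc" "lc < 0" "l + lc = r" using lc_bounds s l_add by auto
    have "\<epsilon> n \<le> r" for n using dl[of n] lc by linarith
    moreover have "\<epsilon> (n + 1) = 0" if "\<epsilon> n = r" for n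
    proof -
      have "l * x (n - 1) < l" using x[of "n - 1"] l_pos by simp
      then have "x n < l - r" using rec'[of n] that by simp
      then have "l * x n < l * (l - r)" using l_pos by simp
      also have "\<dots> = 1" using l_sq s by (simp add: algebra_simps)
      finally show ?thesis using rec[of n] x[of "n + 1"] d0[of "n + 1"] by linarith
    qed
    ultimately show ?thesis unfolding admissible_def using d0 s by auto
  qed
qed

text \<open>The state \<open>p\<close> says whether the digits read so far end in a prefix of a forbidden block.\<close>

definition transition :: "bool \<Rightarrow> int \<Rightarrow> bool \<Rightarrow> bool" where
  "transition p d q \<longleftrightarrow> 0 \<le> d \<and>
     (if \<sigma> = -1 then d \<le> r \<and> (p \<longrightarrow> d = 0) \<and> (q \<longleftrightarrow> d = r)
      else d \<le> r - 1 \<and> (p \<longrightarrow> d \<noteq> r - 1) \<and> (q \<longleftrightarrow> d = r - 1 \<or> d = r - 2 \<and> p))"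

text \<open>A two-sided sequence has no initial state, so the state is defined by looking back: some
  block \<open>(r-1)(r-2)^j\<close> ends at \<open>n\<close>, or, for \<open>\<sigma> = -1\<close>,
  the digit at \<open>n\<close> is \<open>r\<close>.\<close>

lemma admissible_states:
  assumes "admissible \<epsilon>"
  obtains P where "\<And>n. transition (P (n - 1)) (\<epsilon> n) (P n)"
proof (cases "\<sigma> = 1")
  case True
  define P where "P n \<longleftrightarrow> (\<exists>j::nat. \<epsilon> (n - int j) = r - 1 \<and> (\<forall>i\<in>{1..int j}. \<epsilon> (n - int j + i) = r - 2))" for n
  have adm: "\<And>n. 0 \<le> \<epsilon> n \<and> \<epsilon> n \<le> r - 1"
    "\<And>n j. \<epsilon> n = r - 1 \<Longrightarrow> \<forall>i\<in>{1..int j}. \<epsilon> (n + i) = r - 2 \<Longrightarrow> \<epsilon> (n + int j + 1) \<noteq> r - 1"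
    using assms True unfolding admissible_def by (auto simp del: not_ex)
  have P1: "\<epsilon> n \<noteq> r - 1" if "P (n - 1)" for n
    using that adm(2)[of "n - 1 - int j" j for j] by (auto simp: P_def)
  have P2: "P n \<longleftrightarrow> \<epsilon> n = r - 1 \<or> \<epsilon> n = r - 2 \<and> P (n - 1)" for n
  proof
    assume "P n"
    then obtain j where j: "\<epsilon> (n - int j) = r - 1" "\<forall>i\<in>{1..int j}. \<epsilon> (n - int j + i) = r - 2"
      by (auto simp: P_def)
    show "\<epsilon> n = r - 1 \<or> \<epsilon> n = r - 2 \<and> P (n - 1)"
    proof (cases j)
      case 0
      then show ?thesis using j by simp
    next
      case (Suc k)
      have "\<epsilon> n = r - 2" using bspec[OF j(2), of "int j"] Suc by simp
      moreover have "P (n - 1)" unfolding P_def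
        using j Suc by (intro exI[of _ k]) (auto simp: algebra_simps)
      ultimately show ?thesis by simp
    qed
  next
    assume "\<epsilon> n = r - 1 \<or> \<epsilon> n = r - 2 \<and> P (n - 1)"
    then show "P n"
    proof
      assume "\<epsilon> n = r - 1"
      then show "P n" unfolding P_def by (intro exI[of _ 0]) auto
    next
      assume *: "\<epsilon> n = r - 2 \<and> P (n - 1)"
      then obtain j where j: "\<epsilon> (n - 1 - int j) = r - 1" "\<forall>i\<in>{1..int j}. \<epsilon> (n - 1 - int j + i) = r - 2"
        by (auto simp: P_def)
      have "\<epsilon> (n - int (Suc j) + i) = r - 2" if "i \<in> {1..int (Suc j)}" for i
        using j(2) that * by (cases "i = int (Suc j)") (auto simp: algebra_simps)
      then show "P n" unfolding P_def
        using j by (intro exI[of _ "Suc j"]) (auto simp: algebra_simps)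
    qed
  qed
  have "transition (P (n - 1)) (\<epsilon> n) (P n)" for n
    unfolding transition_def using adm(1)[of n] P1[of n] P2[of n] True by auto
  then show ?thesis using that by blast
next
  case False
  then have s: "\<sigma> = -1" using sigma_cases by simp
  then have adm: "\<And>n. 0 \<le> \<epsilon> n \<and> \<epsilon> n \<le> r" "\<And>n. \<epsilon> n = r \<Longrightarrow> \<epsilon> (n + 1) = 0"
    using assms unfolding admissible_def by auto
  have "transition (\<epsilon> (n - 1) = r) (\<epsilon> n) (\<epsilon> n = r)" for n
    unfolding transition_def using adm(1)[of n] adm(2)[of "n - 1"] s by auto
  then show ?thesis using that[of "\<lambda>n. \<epsilon> n = r"] by blast
qed

lemma transition_plus:
  assumes "transition p d q" "\<sigma> = 1"
  shows "0 \<le> d" "d = r - 1 \<or> d = r - 2 \<or> d \<le> r - 3" "p \<Longrightarrow> d \<noteq> r - 1"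
    "q \<longleftrightarrow> d = r - 1 \<or> d = r - 2 \<and> p"
proof -
  have "\<sigma> \<noteq> -1" using assms(2) by simp
  note t = assms(1)[unfolded transition_def if_not_P[OF this]]
  from t show "0 \<le> d" "d = r - 1 \<or> d = r - 2 \<or> d \<le> r - 3" "p \<Longrightarrow> d \<noteq> r - 1"
    "q \<longleftrightarrow> d = r - 1 \<or> d = r - 2 \<and> p" by auto
qed

lemma transition_minus:
  assumes "transition p d q" "\<sigma> \<noteq> 1"
  shows "0 \<le> d" "d \<le> r" "p \<Longrightarrow> d = 0" "q \<longleftrightarrow> d = r"
proof -
  have "\<sigma> = -1" using sigma_cases assms(2) by simp
  note t = assms(1)[unfolded transition_def if_P[OF this]]
  from t show "0 \<le> d" "d \<le> r" "p \<Longrightarrow> d = 0" "q \<longleftrightarrow> d = r" by auto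
qed

text \<open>State \<open>True\<close> stands for the upper rectangle and \<open>False\<close> for
  the lower one; the bounds are their widths. This is one step of the upper estimate for the
  future.\<close>

lemma transition_future:
  assumes "transition p d q"
  shows "d + (if q then l - \<kappa> else 1) \<le> l * (if p then l - \<kappa> else 1)"
proof (cases "\<sigma> = 1")
  case True
  note lc = parameters_plus[OF True] and tr = transition_plus[OF assms True]
  show ?thesis using tr lc by (cases p) (auto simp del: of_int_diff)
next
  case False
  note lc = parameters_minus[OF False] and tr = transition_minus[OF assms False]
  have "d = r \<or> d \<le> r - 1" using tr by linarith
  then show ?thesis using tr lc by (cases p) auto
qed

text \<open>The intervals are the height ranges of the two rectangles. The slack \<open>e\<close>
  serves \<open>contracted_sequence_bounds\<close>; both ends are treated together because a
  negative \<open>lc\<close> exchanges them.\<close>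

lemma transition_past:
  assumes "transition p d q" "0 \<le> e"
    and "(if p then l - 1 else y0) - e \<le> y" "y \<le> (if p then l else l - 1) + e"
  shows "(if q then l - 1 else y0) - \<bar>lc\<bar> * e \<le> d + lc * y \<and>
    d + lc * y \<le> (if q then l else l - 1) + \<bar>lc\<bar> * e"
proof (cases "\<sigma> = 1")
  case True
  note lc = parameters_plus[OF True] and tr = transition_plus[OF assms(1) True]
  have "lc * ((if p then l - 1 else 0) - e) \<le> lc * y" "lc * y \<le> lc * ((if p then l else l - 1) + e)"
    using assms lc by (auto intro!: mult_left_mono split: if_splits)
  then have y: "(if p then 1 - lc else 0) - lc * e \<le> lc * y" "lc * y \<le> (if p then 1 else 1 - lc) + lc * e"
    using lc by (auto simp: algebra_simps split: if_splits)
  show ?thesis using tr y lc by (cases p) auto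
next
  case False
  note lc = parameters_minus[OF False] and tr = transition_minus[OF assms(1) False]
  have "lc * ((if p then l - 1 else -1) - e) \<ge> lc * y" "lc * y \<ge> lc * ((if p then l else l - 1) + e)"
    using assms lc by (auto intro!: mult_left_mono_neg split: if_splits)
  then have y: "(if p then - 1 - lc else - lc) + \<bar>lc\<bar> * e \<ge> lc * y"
      "lc * y \<ge> (if p then -1 else - 1 - lc) - \<bar>lc\<bar> * e"
    using lc by (auto simp: algebra_simps split: if_splits)
  have "d = r \<or> d = 0 \<and> d \<noteq> r \<or> 1 \<le> d \<and> d \<le> r - 1" using tr lc by linarith
  then show ?thesis using tr y lc by (cases p) auto
qed

section \<open>Digit series and their range\<close>

lemma geometric_bound:
  fixes c :: "nat \<Rightarrow> real"
  assumes "\<And>k. \<bar>c k\<bar> \<le> C" "\<bar>\<rho>\<bar> < 1"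
  shows "summable (\<lambda>k. c k * \<rho> ^ k)" "\<bar>\<Sum>k. c k * \<rho> ^ k\<bar> \<le> C / (1 - \<bar>\<rho>\<bar>)"
proof -
  have g: "(\<lambda>k. C * \<bar>\<rho>\<bar> ^ k) sums (C * (1 / (1 - \<bar>\<rho>\<bar>)))"
    using assms(2) by (intro sums_mult geometric_sums) simp
  have le: "norm (c k * \<rho> ^ k) \<le> C * \<bar>\<rho>\<bar> ^ k" for k
    using assms(1)[of k] by (simp add: abs_mult power_abs mult_right_mono)
  show "summable (\<lambda>k. c k * \<rho> ^ k)"
    by (rule summable_comparison_test'[OF sums_summable[OF g], of 0]) (rule le)
  have "norm (\<Sum>k. c k * \<rho> ^ k) \<le> (\<Sum>k. C * \<bar>\<rho>\<bar> ^ k)"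
    by (rule norm_suminf_le[OF le sums_summable[OF g]])
  then show "\<bar>\<Sum>k. c k * \<rho> ^ k\<bar> \<le> C / (1 - \<bar>\<rho>\<bar>)"
    using sums_unique[OF g] by simp
qed

text \<open>Coordinates of the shifted sequence along the expanding and the contracting eigenline.\<close>

definition future :: "(int \<Rightarrow> int) \<Rightarrow> int \<Rightarrow> real" where
  "future \<epsilon> n = (\<Sum>k. (\<epsilon> (n + 1 + int k) / l) * (1 / l) ^ k)"

definition past :: "(int \<Rightarrow> int) \<Rightarrow> int \<Rightarrow> real" where
  "past \<epsilon> n = (\<Sum>k. \<epsilon> (n - int k) * lc ^ k)"

lemma
  assumes "admissible \<epsilon>"
  shows future_summable: "summable (\<lambda>k. (\<epsilon> (n + 1 + int k) / l) * (1 / l) ^ k)"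
    and future_bounded: "\<bar>future \<epsilon> n\<bar> \<le> (r / l) / (1 - 1 / l)"
    and past_summable: "summable (\<lambda>k. \<epsilon> (n - int k) * lc ^ k)"
    and past_bounded: "\<bar>past \<epsilon> n\<bar> \<le> r / (1 - \<bar>lc\<bar>)"
proof -
  have e: "\<bar>real_of_int (\<epsilon> n)\<bar> \<le> r" for n using admissible_bounds[OF assms, of n] by auto
  have el: "\<bar>real_of_int (\<epsilon> n) / l\<bar> \<le> r / l" for n
    using e[of n] l_pos by (simp add: divide_right_mono)
  show "summable (\<lambda>k. (\<epsilon> (n + 1 + int k) / l) * (1 / l) ^ k)"
    using l_gt_1 by (intro geometric_bound(1)[where C = "r / l"] el) simp
  show "summable (\<lambda>k. \<epsilon> (n - int k) * lc ^ k)"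
    using abs_lc_less_1 by (intro geometric_bound(1)[where C = r] e) simp
  show "\<bar>past \<epsilon> n\<bar> \<le> r / (1 - \<bar>lc\<bar>)"
    unfolding past_def using abs_lc_less_1 by (intro geometric_bound(2)[where C = r] e) simp
  show "\<bar>future \<epsilon> n\<bar> \<le> (r / l) / (1 - 1 / l)"
    unfolding future_def using geometric_bound(2)[of "\<lambda>k. \<epsilon> (n + 1 + int k) / l" "r / l" "1 / l"] el l_gt_1
    by simp
qed

lemma future_rec:
  assumes "admissible \<epsilon>"
  shows "future \<epsilon> n = (\<epsilon> (n + 1) + future \<epsilon> (n + 1)) / l"
proof -
  have "future \<epsilon> n - \<epsilon> (n + 1) / l = (\<Sum>k. (\<epsilon> (n + 1 + int (Suc k)) / l) * (1 / l) ^ Suc k)"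
    unfolding future_def using suminf_split_head[OF future_summable[OF assms, of n]] by simp
  also have "\<dots> = (\<Sum>k. ((\<epsilon> (n + 1 + 1 + int k) / l) * (1 / l) ^ k) * (1 / l))"
    by (intro suminf_cong) (simp add: algebra_simps)
  also have "\<dots> = future \<epsilon> (n + 1) * (1 / l)"
    unfolding future_def by (rule suminf_mult2[OF future_summable[OF assms], symmetric])
  finally show ?thesis by (simp add: add_divide_distrib)
qed

lemma past_rec:
  assumes "admissible \<epsilon>"
  shows "past \<epsilon> n = \<epsilon> n + lc * past \<epsilon> (n - 1)"
proof -
  have "past \<epsilon> n - \<epsilon> n = (\<Sum>k. \<epsilon> (n - int (Suc k)) * lc ^ Suc k)"
    unfolding past_def using suminf_split_head[OF past_summable[OF assms, of n]] by simp
  also have "\<dots> = (\<Sum>k. lc * (\<epsilon> (n - 1 - int k) * lc ^ k))"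
    by (intro suminf_cong) (simp add: algebra_simps)
  also have "\<dots> = lc * past \<epsilon> (n - 1)"
    unfolding past_def by (rule suminf_mult[OF past_summable[OF assms]])
  finally show ?thesis by simp
qed

text \<open>Bounds for \<open>future\<close> are pulled back from later times and bounds for
  \<open>past\<close> carried over from earlier ones, along a common state sequence. They are
  closed; genericity makes them strict.\<close>

lemma future_past_domain:
  assumes adm: "admissible \<epsilon>" and "generic (future \<epsilon> n)" "generic (past \<epsilon> n)"
  shows "domain (future \<epsilon> n) (past \<epsilon> n)"
proof -
  obtain P where P: "\<And>n. transition (P (n - 1)) (\<epsilon> n) (P n)"
    using admissible_states[OF adm] by blast
  have P': "transition (P n) (\<epsilon> (n + 1)) (P (n + 1))" for n using P[of "n + 1"] by simp
  let ?U = "\<lambda>p. if p then l - \<kappa> else 1"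
  \<comment> \<open>A crude slack for both estimates: the two a priori series bounds, plus room for
    the interval ends.\<close>
  define C where "C = (r / l) / (1 - 1 / l) + r / (1 - \<bar>lc\<bar>) + \<bar>l\<bar> + 3"
  have C: "0 \<le> (r / l) / (1 - 1 / l)" "0 \<le> r / (1 - \<bar>lc\<bar>)"
    using l_gt_1 abs_lc_less_1 r_pos by simp_all
  have "0 \<le> future \<epsilon> (n + int 0) \<and> future \<epsilon> (n + int 0) \<le> ?U (P (n + int 0))"
  proof (rule contracted_sequence_bounds[where \<rho> = "1 / l" and C = C and lo = "\<lambda>_. 0"])
    fix e :: real and k
    let ?n = "n + int k"
    assume *: "0 \<le> e" "0 - e \<le> future \<epsilon> (n + int (Suc k))"
      "future \<epsilon> (n + int (Suc k)) \<le> ?U (P (n + int (Suc k))) + e"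
    have n: "n + int (Suc k) = ?n + 1" by simp
    note * = *[unfolded n]
    have d: "0 \<le> \<epsilon> (?n + 1)" using admissible_bounds[OF adm] by simp
    have "- e \<le> \<epsilon> (?n + 1) + future \<epsilon> (?n + 1)" using * d by linarith
    then have "- e / l \<le> future \<epsilon> ?n"
      unfolding future_rec[OF adm, of ?n] using l_pos by (intro divide_right_mono) auto
    moreover have "\<epsilon> (?n + 1) + future \<epsilon> (?n + 1) \<le> l * ?U (P ?n) + e"
      using * transition_future[OF P'[of ?n]] by linarith
    then have "future \<epsilon> ?n \<le> (l * ?U (P ?n) + e) / l"
      unfolding future_rec[OF adm, of ?n] using l_pos by (intro divide_right_mono) auto
    then have "future \<epsilon> ?n \<le> ?U (P ?n) + e / l" using l_pos by (simp add: add_divide_distrib)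
    ultimately show "0 - 1 / l * e \<le> future \<epsilon> ?n \<and> future \<epsilon> ?n \<le> ?U (P ?n) + 1 / l * e"
      by simp
  next
    fix k
    show "0 - C \<le> future \<epsilon> (n + int k) \<and> future \<epsilon> (n + int k) \<le> ?U (P (n + int k)) + C"
      using future_bounded[OF adm, of "n + int k"] C L_parameters unfolding C_def by auto
  qed (use C l_gt_1 in \<open>auto simp: C_def\<close>)
  then have f: "0 \<le> future \<epsilon> n" "future \<epsilon> n \<le> ?U (P n)" by simp_all
  let ?L = "\<lambda>p. if p then l - 1 else real_of_int y0" and ?H = "\<lambda>p. if p then l else l - 1"
  have y01: "\<bar>real_of_int y0\<bar> \<le> 1" by (simp add: y0_def)
  have "?L (P (n - int 0)) \<le> past \<epsilon> (n - int 0) \<and> past \<epsilon> (n - int 0) \<le> ?H (P (n - int 0))"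
  proof (rule contracted_sequence_bounds[where \<rho> = "\<bar>lc\<bar>" and C = C])
    fix e :: real and k
    let ?n = "n - int k"
    assume *: "0 \<le> e" "?L (P (n - int (Suc k))) - e \<le> past \<epsilon> (n - int (Suc k))"
      "past \<epsilon> (n - int (Suc k)) \<le> ?H (P (n - int (Suc k))) + e"
    have n: "n - int (Suc k) = ?n - 1" by simp
    show "?L (P ?n) - \<bar>lc\<bar> * e \<le> past \<epsilon> ?n \<and> past \<epsilon> ?n \<le> ?H (P ?n) + \<bar>lc\<bar> * e"
      unfolding past_rec[OF adm, of ?n] by (rule transition_past[OF P *[unfolded n]])
  next
    fix k
    show "?L (P (n - int k)) - C \<le> past \<epsilon> (n - int k) \<and> past \<epsilon> (n - int k) \<le> ?H (P (n - int k)) + C"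
      using past_bounded[OF adm, of "n - int k"] C y01 l_pos unfolding C_def by auto
  qed (use C abs_lc_less_1 in \<open>auto simp: C_def\<close>)
  then have p: "?L (P n) \<le> past \<epsilon> n" "past \<epsilon> n \<le> ?H (P n)" by simp_all
  have "future \<epsilon> n \<noteq> 0" "future \<epsilon> n \<noteq> 1" "future \<epsilon> n \<noteq> l - \<kappa>"
    using generic_neq[OF assms(2), of 0 0] generic_neq[OF assms(2), of 1 0]
      generic_neq[OF assms(2), of "- \<kappa>" 1] by auto
  moreover have "past \<epsilon> n \<noteq> y0" "past \<epsilon> n \<noteq> l" "past \<epsilon> n \<noteq> l - 1"
    using generic_neq[OF assms(3), of y0 0] generic_neq[OF assms(3), of 0 1]
      generic_neq[OF assms(3), of "- 1" 1] by auto
  moreover have "real_of_int y0 < l - 1"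
  proof -
    have "real_of_int y0 \<le> 0" by (simp add: y0_def)
    then show ?thesis using l_gt_1 by linarith
  qed
  ultimately show ?thesis
    using f p L_parameters unfolding domain_def by (cases "P n") auto
qed

lemma lc_nonzero: "lc \<noteq> 0"
  using l_mult sigma_cases by auto

lemma inverse_lc: "1 / lc = \<sigma> * l"
proof -
  have "lc * (\<sigma> * l) = 1" using l_mult by (simp add: mult.left_commute mult.commute)
  then show ?thesis using lc_nonzero by (simp add: field_simps)
qed

lemma generic_divide_lc:
  assumes "generic x" shows "generic (x / lc)"
proof -
  have "x / lc = \<sigma> * (l * x)" using inverse_lc by (simp add: divide_inverse mult.assoc)
  then show ?thesis using generic_sigma_mult[OF generic_l_mult[OF assms]] by simp
qed

lemma generic_powi_mult:
  assumes "generic x"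
  shows "generic (l powi n * x)" "generic (lc powi n * x)"
proof (induction n rule: int_induct[where k = 0])
  case base
  show "generic (l powi 0 * x)" "generic (lc powi 0 * x)" using assms by simp_all
next
  case (step1 i)
  show "generic (l powi (i + 1) * x)"
    using generic_l_mult[OF step1(2)] l_pos by (simp add: power_int_add_1' mult.assoc)
  show "generic (lc powi (i + 1) * x)"
    using generic_lc_mult[OF step1(3)] lc_nonzero by (simp add: power_int_add_1' mult.assoc)
next
  case (step2 i)
  show "generic (l powi (i - 1) * x)"
    using generic_divide_l[OF step2(2)] l_pos by (simp add: power_int_diff)
  show "generic (lc powi (i - 1) * x)"
    using generic_divide_lc[OF step2(3)] lc_nonzero by (simp add: power_int_diff)
qed

text \<open>The code of a point is read off the orbit of its representatives in the domain: the
  representative of the next iterate differs from the image of the current one by a digit,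
  because the domain is mapped into itself by \<open>domain_forward\<close>.\<close>

lemma code_exists:
  assumes "generic A" "generic B"
  obtains \<epsilon> and p q :: int where "admissible \<epsilon>"
    "future \<epsilon> 0 = A + (p + q * l)" "past \<epsilon> 0 = B - (p + q * lc)"
proof -
  have "\<exists>(p::int) (q::int). domain (l powi n * A + (p + q * l)) (lc powi n * B - (p + q * lc))" for n
    using domain_translate_exists[OF generic_powi_mult(1)[OF assms(1)] generic_powi_mult(2)[OF assms(2)]]
    by metis
  then obtain p q :: "int \<Rightarrow> int" where
    dom0: "\<And>n. domain (l powi n * A + (p n + q n * l)) (lc powi n * B - (p n + q n * lc))"
    by metis
  define X where "X n = l powi n * A + (p n + q n * l)" for n
  define Y where "Y n = lc powi n * B - (p n + q n * lc)" for n
  define \<epsilon> where "\<epsilon> n = \<lfloor>l * X (n - 1)\<rfloor>" for n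
  have dom: "domain (X n) (Y n)" for n using dom0 by (simp add: X_def Y_def)
  have genX: "generic (X n)" for n
    unfolding X_def by (intro generic_add generic_powi_mult assms)
  have rec: "X (n + 1) = l * X n - \<epsilon> (n + 1) \<and> Y (n + 1) = lc * Y n + \<epsilon> (n + 1)" for n
  proof -
    \<comment> \<open>\<open>P + Q * l\<close> is the difference between the representative at time
      \<open>n + 1\<close> and the image of the one at time \<open>n\<close>, with
      \<open>l * l\<close> reduced to \<open>r * l - \<sigma>\<close>.\<close>
    define P Q where "P = p (n + 1) + \<sigma> * q n + \<epsilon> (n + 1)" and "Q = q (n + 1) - p n - r * q n"
    have X: "X (n + 1) = (l * X n - \<epsilon> (n + 1)) + (P + Q * l)"
    proof -
      have pw: "l powi (n + 1) = l * l powi n" using l_pos by (simp add: power_int_add_1')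
      have "l * X n = l powi (n + 1) * A + (p n * l + q n * (l * l))"
        unfolding pw by (simp add: X_def algebra_simps)
      then show ?thesis unfolding l_sq P_def Q_def by (simp add: X_def algebra_simps)
    qed
    have Y: "Y (n + 1) = (lc * Y n + \<epsilon> (n + 1)) - (P + Q * lc)"
    proof -
      have pw: "lc powi (n + 1) = lc * lc powi n" using lc_nonzero by (simp add: power_int_add_1')
      have "lc * Y n = lc powi (n + 1) * B - (p n * lc + q n * (lc * lc))"
        unfolding pw by (simp add: Y_def algebra_simps)
      then show ?thesis unfolding lc_sq P_def Q_def by (simp add: Y_def algebra_simps)
    qed
    have "domain (l * X n - \<epsilon> (n + 1)) (lc * Y n + \<epsilon> (n + 1))"
      using domain_forward[OF dom genX, of n] by (simp add: \<epsilon>_def)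
    moreover have "domain ((l * X n - \<epsilon> (n + 1)) + (P + Q * l)) ((lc * Y n + \<epsilon> (n + 1)) - (P + Q * lc))"
      using dom[of "n + 1"] unfolding X Y .
    ultimately have "P = 0 \<and> Q = 0" by (rule domain_translate_unique)
    then show ?thesis using X Y by simp
  qed
  have bounds: "0 < X n" "X n < 1" "\<bar>X n\<bar> \<le> 1" "\<bar>Y n\<bar> \<le> l + 1" for n
  proof -
    have "\<bar>real_of_int y0\<bar> \<le> 1" by (simp add: y0_def)
    then show "0 < X n" "X n < 1" "\<bar>X n\<bar> \<le> 1" "\<bar>Y n\<bar> \<le> l + 1"
      using dom[of n] l_pos unfolding domain_def by auto
  qed
  have adm: "admissible \<epsilon>"
    using bounds rec by (intro greedy_digits_admissible[of X]) auto
  have "(\<lambda>k. (\<epsilon> (0 + 1 + int k) / l) * (1 / l) ^ k) sums X (int 0)"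
  proof (rule bounded_recursion_sums)
    fix k
    show "X (int k) = \<epsilon> (0 + 1 + int k) / l + 1 / l * X (int (Suc k))"
      using rec[of "int k"] l_pos by (simp add: field_simps)
  qed (use bounds l_gt_1 in auto)
  then have "future \<epsilon> 0 = X 0" unfolding future_def by (simp add: sums_iff)
  moreover have "(\<lambda>k. \<epsilon> (0 - int k) * lc ^ k) sums Y (- int 0)"
  proof (rule bounded_recursion_sums)
    fix k
    show "Y (- int k) = \<epsilon> (0 - int k) + lc * Y (- int (Suc k))"
      using rec[of "- int (Suc k)"] by simp
  qed (use bounds abs_lc_less_1 in auto)
  then have "past \<epsilon> 0 = Y 0" unfolding past_def by (simp add: sums_iff)
  ultimately show ?thesis using that[OF adm, of "p 0" "q 0"] by (simp add: X_def Y_def)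
qed

text \<open>Conversely, by uniqueness of translates, two codes of the same point have the same
  coordinates at all times.\<close>

lemma code_unique:
  fixes p q :: int
  assumes adm: "admissible \<epsilon>" "admissible \<epsilon>'"
    and gen: "generic (future \<epsilon> 0)" "generic (past \<epsilon> 0)"
    and eq: "future \<epsilon>' 0 = future \<epsilon> 0 + (p + q * l)" "past \<epsilon>' 0 = past \<epsilon> 0 - (p + q * lc)"
  shows "\<epsilon> = \<epsilon>'"
proof -
  have transfer: "future \<epsilon>' n = future \<epsilon> n \<and> past \<epsilon>' n = past \<epsilon> n"
    if "generic (future \<epsilon> n)" "generic (past \<epsilon> n)"
      and e: "future \<epsilon>' n = future \<epsilon> n + (of_int p + of_int q * l)"
        "past \<epsilon>' n = past \<epsilon> n - (of_int p + of_int q * lc)" for n and p q :: int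
  proof -
    have "domain (future \<epsilon> n) (past \<epsilon> n)" using future_past_domain adm that by blast
    moreover have "domain (future \<epsilon>' n) (past \<epsilon>' n)"
    proof (rule future_past_domain[OF adm(2)])
      show "generic (future \<epsilon>' n)" unfolding e by (intro generic_add that)
      show "generic (past \<epsilon>' n)" unfolding e by (intro generic_diff_conj that)
    qed
    ultimately have "p = 0 \<and> q = 0" unfolding e by (rule domain_translate_unique)
    then show ?thesis using e by simp
  qed
  have up: "future \<epsilon> (n + 1) = l * future \<epsilon> n - \<epsilon> (n + 1)" "past \<epsilon> (n + 1) = \<epsilon> (n + 1) + lc * past \<epsilon> n"
    if "admissible \<epsilon>" for \<epsilon> n
    using future_rec[OF that, of n] past_rec[OF that, of "n + 1"] l_pos by (auto simp: field_simps)
  have down: "future \<epsilon> (n - 1) = (future \<epsilon> n + \<epsilon> n) / l" "past \<epsilon> (n - 1) = (past \<epsilon> n - \<epsilon> n) / lc"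
    if "admissible \<epsilon>" for \<epsilon> n
    using future_rec[OF that, of "n - 1"] past_rec[OF that, of n] lc_nonzero
    by (auto simp: add.commute)
  have all: "generic (future \<epsilon> n) \<and> generic (past \<epsilon> n) \<and> future \<epsilon>' n = future \<epsilon> n \<and> past \<epsilon>' n = past \<epsilon> n" for n
  proof (induction n rule: int_induct[where k = 0])
    case base
    show ?case using gen transfer[OF gen eq] by simp
  next
    case (step1 n)
    \<comment> \<open>Different digits would shift \<open>future\<close> by an integer and
      \<open>past\<close> by its negative, which is a lattice translation, so
      \<open>transfer\<close> applies.\<close>
    let ?d = "\<epsilon> (n + 1) - \<epsilon>' (n + 1)"
    have "generic (l * future \<epsilon> n + (of_int (- \<epsilon> (n + 1)) + of_int 0 * l))"
      using step1 by (intro generic_add generic_l_mult) simp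
    then have g1: "generic (future \<epsilon> (n + 1))" by (simp add: up adm)
    have "generic (lc * past \<epsilon> n + (of_int (\<epsilon> (n + 1)) + of_int 0 * l))"
      using step1 by (intro generic_add generic_lc_mult) simp
    then have g2: "generic (past \<epsilon> (n + 1))" unfolding up(2)[OF adm(1)] by (simp add: add.commute)
    have "future \<epsilon>' (n + 1) = future \<epsilon> (n + 1) + (of_int ?d + of_int 0 * l)"
      "past \<epsilon>' (n + 1) = past \<epsilon> (n + 1) - (of_int ?d + of_int 0 * lc)"
      using step1 by (simp_all add: up adm)
    from transfer[OF g1 g2 this] show ?case using g1 g2 by simp
  next
    case (step2 n)
    define d where "d = \<epsilon>' n - \<epsilon> n"
    have "generic ((future \<epsilon> n + (of_int (\<epsilon> n) + of_int 0 * l)) / l)"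
      using step2 by (intro generic_add generic_divide_l) simp
    then have g1: "generic (future \<epsilon> (n - 1))" by (simp add: down adm)
    have "generic ((past \<epsilon> n + (of_int (- \<epsilon> n) + of_int 0 * l)) / lc)"
      using step2 by (intro generic_add generic_divide_lc) simp
    then have g2: "generic (past \<epsilon> (n - 1))" by (simp add: down adm)
    have "future \<epsilon>' (n - 1) = future \<epsilon> (n - 1) + d * (1 / l)"
      using step2 by (simp add: down adm d_def diff_divide_distrib add_divide_distrib)
    \<comment> \<open>Dividing by the units \<open>l\<close> and \<open>lc\<close> keeps the digit
      difference in Z[\<lambda>], and the two quotients are conjugate, as \<open>transfer\<close>
      requires.\<close>
    also have "d * (1 / l) = of_int (d * \<sigma> * r) + of_int (- (d * \<sigma>)) * l"
      unfolding inverse_l by (simp add: lc_eq algebra_simps)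
    finally have e1: "future \<epsilon>' (n - 1) = future \<epsilon> (n - 1) + (of_int (d * \<sigma> * r) + of_int (- (d * \<sigma>)) * l)" .
    have "past \<epsilon>' (n - 1) = past \<epsilon> (n - 1) - d * (1 / lc)"
      using step2 by (simp add: down adm d_def diff_divide_distrib)
    also have "d * (1 / lc) = of_int (d * \<sigma> * r) + of_int (- (d * \<sigma>)) * lc"
      unfolding inverse_lc by (simp add: lc_eq algebra_simps)
    finally have e2: "past \<epsilon>' (n - 1) = past \<epsilon> (n - 1) - (of_int (d * \<sigma> * r) + of_int (- (d * \<sigma>)) * lc)" .
    from transfer[OF g1 g2 e1 e2] show ?case using g1 g2 by simp
  qed
  show ?thesis
  proof
    fix n
    have "real_of_int (\<epsilon> n) = l * future \<epsilon> (n - 1) - future \<epsilon> n"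
      "real_of_int (\<epsilon>' n) = l * future \<epsilon>' (n - 1) - future \<epsilon>' n"
      using up(1)[OF adm(1), of "n - 1"] up(1)[OF adm(2), of "n - 1"] by simp_all
    then show "\<epsilon> n = \<epsilon>' n" using all[of n] all[of "n - 1"] by simp
  qed
qed

end

subsection \<open>The torus\<close>

text \<open>These continuous characters separate points, which makes the quotient topology
  Hausdorff. Hence limits defining codings are unique and compact images are closed.\<close>

lift_definition torus_char :: "2 \<Rightarrow> torus \<Rightarrow> complex" is "\<lambda>i x. cis (2 * pi * x $ i)"
proof -
  fix i and x y :: "real^2"
  assume "lattice_rel x y"
  then obtain n where "x $ i - y $ i = of_int n" by (auto simp: lattice_rel_def elim: Ints_cases)
  then have "x $ i = y $ i + of_int n" by simp
  then have "\<exists>n::int. 2 * pi * x $ i = 2 * pi * y $ i + 2 * pi * n"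
    by (intro exI[of _ n]) (simp add: algebra_simps)
  then show "cis (2 * pi * x $ i) = cis (2 * pi * y $ i)"
    unfolding sin_cos_eq_iff[symmetric] by (simp add: complex_eq_iff)
qed

lemma torus_of_eq_iff: "torus_of x = torus_of y \<longleftrightarrow> lattice_rel x y"
  by (simp add: torus.abs_eq_iff)

lemma torus_char_inject: "(\<forall>i. torus_char i p = torus_char i q) \<longleftrightarrow> p = q"
proof
  assume *: "\<forall>i. torus_char i p = torus_char i q"
  obtain x y where xy: "p = torus_of x" "q = torus_of y"
    by (metis Quotient3_abs_rep Quotient3_torus)
  have "x $ i - y $ i \<in> \<int>" for i
  proof -
    have "sin (2 * pi * x $ i) = sin (2 * pi * y $ i) \<and> cos (2 * pi * x $ i) = cos (2 * pi * y $ i)"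
      using * unfolding xy torus_char.abs_eq by (simp add: complex_eq_iff)
    then obtain n :: int where "2 * pi * x $ i = 2 * pi * y $ i + 2 * pi * n"
      unfolding sin_cos_eq_iff by blast
    then have "2 * pi * (x $ i - y $ i) = 2 * pi * n" by (simp add: algebra_simps)
    then have "x $ i - y $ i = n" by simp
    then show ?thesis by simp
  qed
  then show "p = q" unfolding xy torus_of_eq_iff lattice_rel_def by blast
qed simp

lemma torus_of_surj: obtains x where "p = torus_of x"
  by (metis Quotient3_abs_rep Quotient3_torus)

lemma continuous_on_torus_of: "continuous_on UNIV torus_of"
  by (simp add: continuous_on_open_vimage open_torus_def)

lemma continuous_on_torus_char: "continuous_on UNIV (torus_char i)"
proof -
  have "open (torus_of -` torus_char i -` U)" if "open U" for U
  proof -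
    have "torus_of -` torus_char i -` U = (\<lambda>x. cis (2 * pi * x $ i)) -` U"
      by (auto simp: torus_char.abs_eq)
    moreover have "continuous_on UNIV (\<lambda>x::real^2. cis (2 * pi * x $ i))"
      by (intro continuous_intros)
    ultimately show ?thesis using that by (simp add: continuous_on_open_vimage)
  qed
  then show ?thesis by (simp add: continuous_on_open_vimage open_torus_def)
qed

instance torus :: t2_space
proof
  fix p q :: torus
  assume "p \<noteq> q"
  then obtain i where "torus_char i p \<noteq> torus_char i q" using torus_char_inject by blast
  then obtain U V where UV: "open U" "open V" "torus_char i p \<in> U" "torus_char i q \<in> V" "U \<inter> V = {}"
    using hausdorff[of "torus_char i p" "torus_char i q"] by metis
  have "open (torus_char i -` U)" "open (torus_char i -` V)"
    using UV continuous_on_torus_char[of i] by (simp_all add: continuous_on_open_vimage)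
  then show "\<exists>U V. open U \<and> open V \<and> p \<in> U \<and> q \<in> V \<and> U \<inter> V = {}"
    using UV by (intro exI[of _ "torus_char i -` U"] exI[of _ "torus_char i -` V"]) auto
qed

lemma tendsto_torus_of:
  fixes x :: "real^2"
  assumes "(f \<longlongrightarrow> x) F" shows "((\<lambda>n. torus_of (f n)) \<longlongrightarrow> torus_of x) F"
  using continuous_on_tendsto_compose[OF continuous_on_torus_of assms] by simp

text \<open>The image of the \<open>e\<close>-ball is open because its preimage is the union of the
  \<open>e\<close>-balls around all integer vectors.\<close>

lemma tendsto_torus_of_zero:
  assumes "(\<lambda>n. torus_of (f n)) \<longlonglongrightarrow> torus_of 0" "0 < e"
  shows "\<forall>\<^sub>F n in sequentially. \<exists>w. (\<forall>i. w $ i \<in> \<int>) \<and> norm (f n - w) < e"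
proof -
  define U where "U = torus_of ` ball 0 e"
  have vim: "torus_of -` U = (\<Union>w\<in>{w. \<forall>i. w $ i \<in> \<int>}. ball w e)"
  proof (intro set_eqI iffI)
    fix x assume "x \<in> torus_of -` U"
    then obtain y where "norm y < e" "lattice_rel x y"
      by (auto simp: U_def torus_of_eq_iff)
    then show "x \<in> (\<Union>w\<in>{w. \<forall>i. w $ i \<in> \<int>}. ball w e)"
      by (intro UN_I[of "x - y"]) (auto simp: lattice_rel_def dist_norm norm_minus_commute)
  next
    fix x :: "real^2" assume "x \<in> (\<Union>w\<in>{w. \<forall>i. w $ i \<in> \<int>}. ball w e)"
    then obtain w where w: "\<forall>i. w $ i \<in> \<int>" "dist w x < e" by auto
    then have "torus_of x = torus_of (x - w)" "x - w \<in> ball 0 e"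
      by (auto simp: torus_of_eq_iff lattice_rel_def dist_norm norm_minus_commute)
    then show "x \<in> torus_of -` U" by (auto simp: U_def)
  qed
  have "open U" unfolding open_torus_def vim by auto
  moreover have "torus_of 0 \<in> U" using assms(2) by (auto simp: U_def)
  ultimately have "\<forall>\<^sub>F n in sequentially. torus_of (f n) \<in> U"
    using topological_tendstoD[OF assms(1)] by blast
  then show ?thesis
  proof eventually_elim
    case (elim n)
    then have "f n \<in> torus_of -` U" by simp
    then show ?case unfolding vim by (auto simp: dist_norm norm_minus_commute)
  qed
qed

section \<open>Null sets on the torus\<close>

lemma measurable_torus_of: "torus_of \<in> borel_measurable borel"
  by (rule borel_measurable_continuous_onI[OF continuous_on_torus_of])

text \<open>The image of a closed set need not be closed, as for a line of irrational slope, but it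
  is a countable union of compact images.\<close>

lemma borel_torus_of_image_closed:
  fixes S :: "(real^2) set"
  assumes "closed S" shows "torus_of ` S \<in> sets borel"
proof -
  have "S = (\<Union>n. S \<inter> cball 0 (real n))"
    using real_arch_simple by (auto simp: mem_cball)
  then have "torus_of ` S = (\<Union>n. torus_of ` (S \<inter> cball 0 (real n)))" by blast
  moreover have "compact (torus_of ` (S \<inter> cball 0 (real n)))" for n
    using assms by (intro compact_continuous_image continuous_on_subset[OF continuous_on_torus_of]
      closed_Int_compact) auto
  then have "torus_of ` (S \<inter> cball 0 (real n)) \<in> sets borel" for n
    by (intro borel_closed compact_imp_closed)
  ultimately show ?thesis by (auto intro: sets.countable_UN)
qed

lemma fundamental_square_measurable:
  "{x :: real^2. \<forall>i. 0 \<le> x $ i \<and> x $ i < 1} \<inter> space lborel \<in> sets lborel"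
  by measurable

text \<open>The measure comes from the unit square, so a point outside \<open>\<Union>F\<close> must
  have its whole class outside; this is the role of \<open>inv\<close>.\<close>

lemma AE_torus_lebesgue:
  fixes F :: "(real^2) set set"
  assumes "countable F" and F: "\<And>S. S \<in> F \<Longrightarrow> closed S \<and> negligible S"
    and inv: "\<And>v w. lattice_rel v w \<Longrightarrow> v \<in> \<Union>F \<Longrightarrow> w \<in> \<Union>F"
  shows "AE p in torus_lebesgue. p \<notin> torus_of ` \<Union>F"
proof -
  have "torus_of ` \<Union>F = (\<Union>S\<in>F. torus_of ` S)" by blast
  also have "\<dots> \<in> sets borel"
    using F by (intro sets.countable_UN'[OF assms(1)]) (blast intro: borel_torus_of_image_closed)
  finally have meas: "torus_of ` \<Union>F \<in> sets borel" .
  have "AE x in lborel. x \<notin> S" if "S \<in> F" for S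
    using F[OF that] unfolding negligible_iff_null_sets
    by (metis AE_completion_iff AE_not_in)
  then have "AE x in lborel. \<forall>S\<in>F. x \<notin> S"
    using assms(1) by (simp add: AE_ball_countable)
  then have "AE x in lborel. torus_of x \<notin> torus_of ` \<Union>F"
  proof eventually_elim
    case (elim x)
    have "lattice_rel y x" if "torus_of x = torus_of y" for y
      using that torus_of_eq_iff by metis
    then show ?case using inv elim by blast
  qed
  then have "AE x in restrict_space lborel {x :: real^2. \<forall>i. 0 \<le> x $ i \<and> x $ i < 1}.
      torus_of x \<notin> torus_of ` \<Union>F"
    unfolding AE_restrict_space_iff[OF fundamental_square_measurable] by eventually_elim simp
  then show ?thesis
    unfolding torus_lebesgue_def using meas measurable_torus_of
    by (subst AE_distr_iff) (auto intro: measurable_restrict_space1 simp: Compl_eq[symmetric])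
qed

text \<open>The measure is nonzero, as the square contains an open box. Therefore a
  point-independent statement that holds almost everywhere is true.\<close>

lemma AE_torus_lebesgue_ex:
  assumes "AE p in torus_lebesgue. P p" shows "\<exists>p. P p"
proof (rule ccontr)
  let ?Q = "{x :: real^2. \<forall>i. 0 \<le> x $ i \<and> x $ i < 1}"
  assume "\<not> (\<exists>p. P p)"
  then have "AE p in torus_lebesgue. False" using assms by simp
  then have "AE x in restrict_space lborel ?Q. False"
    unfolding torus_lebesgue_def
    by (rule AE_distrD[rotated]) (simp add: measurable_restrict_space1 measurable_torus_of)
  then have "AE x in lborel. x \<notin> ?Q"
    unfolding AE_restrict_space_iff[OF fundamental_square_measurable] by eventually_elim simp
  then have "AE x in lebesgue. x \<notin> ?Q" by (rule AE_completion)
  then have "?Q \<in> null_sets lebesgue"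
    using fundamental_square_measurable by (subst AE_iff_null_sets) auto
  then have "negligible ?Q" by (simp add: negligible_iff_null_sets)
  then have "negligible (box 0 (1 :: real^2))"
    by (rule negligible_subset) (auto simp: mem_box_cart less_imp_le)
  moreover have "box 0 (1 :: real^2) \<noteq> {}"
    by (auto simp: mem_box_cart intro!: exI[of _ "\<chi> i. 1 / 2"] simp flip: ex_in_conv)
  ultimately show False using open_not_negligible[OF open_box] by blast
qed

subsection \<open>Hyperbolic toral automorphisms\<close>

lemma int_matrix_mult_vec:
  "real_matrix M *v (\<chi> i. real_of_int (z $ i)) = (\<chi> i. real_of_int ((M *v z) $ i))"
  by (simp add: vec_eq_iff matrix_vector_mult_def)

lemma det_unit:
  assumes "invertible (M :: int^2^2)" shows "det M = 1 \<or> det M = -1"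
proof -
  obtain B where "M ** B = mat 1" using assms by (auto simp: invertible_def)
  then have "det M * det B = 1" by (metis det_I det_mul)
  then show ?thesis by (auto simp: zmult_eq_1_iff)
qed

lemma hyperbolic_trace:
  assumes "hyperbolic_matrix M" "0 < trace M" "det M = 1"
  shows "3 \<le> trace M"
proof (rule ccontr)
  assume "\<not> 3 \<le> trace M"
  then have tr: "trace M = 1 \<or> trace M = 2" using assms(2) by linarith
  define a b c d where "a = M$1$1" and "b = M$1$2" and "c = M$2$1" and "d = M$2$2"
  have td: "trace M = a + d" "det M = a * d - b * c"
    by (simp_all add: trace_def sum_2 det_2 a_def b_def c_def d_def)
  have hyp: "cmod z \<noteq> 1" if "v \<noteq> 0" "of_int a * v$1 + of_int b * v$2 = z * v$1"
    "of_int c * v$1 + of_int d * v$2 = z * v$2" for z and v :: "complex^2"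
  proof -
    have "map_matrix of_int M *v v = z *s v"
      using that(2,3) by (simp add: vec_eq_iff forall_2 matrix_vector_mult_def sum_2 a_def b_def c_def d_def)
    then show ?thesis using assms(1) that(1) unfolding hyperbolic_matrix_def by blast
  qed
  show False
  proof (cases "b = 0")
    case True
    then have "d = 1 \<or> d = -1" using td assms(3) by (auto simp: zmult_eq_1_iff)
    then have "cmod (of_int d) = 1" by auto
    moreover have "cmod (of_int d) \<noteq> 1"
      by (rule hyp[of "vector [0, 1]"]) (simp_all add: True vec_eq_iff forall_2)
    ultimately show False by simp
  next
    case False
    \<comment> \<open>A root of \<open>z^2 - trace M * z + 1\<close> on the unit circle: 1 for trace
      2, a primitive sixth root of unity for trace 1.\<close>
    define z where "z = (if trace M = 2 then 1 else Complex (1/2) (sqrt 3 / 2))"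
    have zz: "z * z - of_int (a + d) * z + of_int (a * d - b * c) = 0"
      using tr assms(3) unfolding td[symmetric] z_def
      by (auto simp: complex_eq_iff)
    have "cmod z = 1" unfolding z_def by (simp add: cmod_def power2_eq_square)
    moreover have "cmod z \<noteq> 1"
    \<comment> \<open>The first row determines this eigenvector; the second row is then the
      characteristic equation.\<close>
    proof (rule hyp[of "vector [of_int b, z - of_int a]"])
      show "vector [of_int b, z - of_int a] \<noteq> (0 :: complex^2)"
        using False by (auto simp: vec_eq_iff forall_2)
    qed (use zz in \<open>simp_all add: algebra_simps\<close>)
    ultimately show False by simp
  qed
qed

text \<open>For \<open>\<sigma> = 1\<close>, \<open>r^2 - 4\<close> lies strictly between
  \<open>(r - 1)^2\<close> and \<open>r^2\<close>. For \<open>\<sigma> = -1\<close>,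
  \<open>r^2 + 4\<close> lies between \<open>r^2\<close> and \<open>(r + 2)^2\<close>, and parity
  excludes \<open>(r + 1)^2\<close>.\<close>

lemma discr_not_square:
  fixes r \<sigma> k :: int
  assumes "\<sigma> = 1 \<and> 3 \<le> r \<or> \<sigma> = -1 \<and> 0 < r" and eq: "(r\<^sup>2 - 4 * \<sigma>) * n\<^sup>2 = k\<^sup>2"
  shows "n = 0"
proof (rule ccontr)
  assume n: "n \<noteq> 0"
  have "n\<^sup>2 dvd k\<^sup>2" using eq by (metis dvd_triv_right)
  then have "n dvd k" by simp
  then obtain m' where "k = n * m'" by (auto simp: dvd_def)
  then have "n\<^sup>2 * (r\<^sup>2 - 4 * \<sigma>) = n\<^sup>2 * m'\<^sup>2" using eq by (simp add: power_mult_distrib mult.commute)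
  then have "r\<^sup>2 - 4 * \<sigma> = m'\<^sup>2" using n by simp
  define m where "m = \<bar>m'\<bar>"
  have m: "r * r - 4 * \<sigma> = m * m" "0 \<le> m"
    using \<open>r\<^sup>2 - 4 * \<sigma> = m'\<^sup>2\<close> by (simp_all add: m_def power2_eq_square)
  from assms(1) show False
  proof
    assume s: "\<sigma> = 1 \<and> 3 \<le> r"
    have "m < r" using m s by (intro power2_less_imp_less[of m r]) (auto simp: power2_eq_square)
    then have "m * m \<le> (r - 1) * (r - 1)" using m by (intro mult_mono) auto
    then show False using m s by (simp add: algebra_simps)
  next
    assume s: "\<sigma> = -1 \<and> 0 < r"
    have "r < m" using m s by (intro power2_less_imp_less[of r m]) (auto simp: power2_eq_square)
    show False
    proof (cases "m = r + 1")
      case True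
      then have "2 * r = 3" using m s by (simp add: algebra_simps)
      then show False by presburger
    next
      case False
      then have "(r + 2) * (r + 2) \<le> m * m" using \<open>r < m\<close> s by (intro mult_mono) auto
      then show False using m s by (simp add: algebra_simps)
    qed
  qed
qed

section \<open>Coset representatives of a sublattice of the integer plane\<close>

definition det2 :: "int^2 \<Rightarrow> int^2 \<Rightarrow> int" where
  "det2 u v = u$1 * v$2 - u$2 * v$1"

text \<open>The lattice is generated by \<open>(g, 0)\<close> and \<open>(p, q)\<close>: the second
  coordinate fixes its remainder and \<open>n\<close>, and then the first coordinate fixes its
  remainder modulo \<open>g\<close>.\<close>

lemma triangular_lattice_reps:
  fixes g p q X Y :: int
  assumes "0 < g" "q \<noteq> 0"
  shows "\<exists>!ij. ij \<in> {0..<g} \<times> {0..<\<bar>q\<bar>} \<and>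
    (\<exists>m n. X = fst ij + m * g + n * p \<and> Y = snd ij + n * q)"
proof (rule ex_ex1I)
  \<comment> \<open>The sign corrects for reducing modulo \<open>\<bar>q\<bar>\<close> while the
    generator is \<open>q\<close>.\<close>
  define n where "n = sgn q * (Y div \<bar>q\<bar>)"
  have "Y = Y mod \<bar>q\<bar> + \<bar>q\<bar> * (Y div \<bar>q\<bar>)" by simp
  also have "\<bar>q\<bar> * (Y div \<bar>q\<bar>) = n * q"
    unfolding n_def by (metis abs_sgn mult.assoc mult.commute)
  finally have "Y = Y mod \<bar>q\<bar> + n * q" .
  moreover have "X = (X - n * p) mod g + (X - n * p) div g * g + n * p" by simp
  ultimately show "\<exists>ij. ij \<in> {0..<g} \<times> {0..<\<bar>q\<bar>} \<and>
    (\<exists>m n. X = fst ij + m * g + n * p \<and> Y = snd ij + n * q)"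
    using assms
    by (intro exI[of _ "((X - n * p) mod g, Y mod \<bar>q\<bar>)"] conjI exI[of _ "(X - n * p) div g"] exI[of _ n])
      simp_all
next
  have coords: "j = Y mod \<bar>q\<bar> \<and> n = (Y - j) div q \<and> i = (X - n * p) mod g"
    if "0 \<le> i" "i < g" "0 \<le> j" "j < \<bar>q\<bar>" "X = i + m * g + n * p" "Y = j + n * q" for i j m n
  proof -
    have "\<bar>q\<bar> dvd n * q" by simp
    then have "Y mod \<bar>q\<bar> = j mod \<bar>q\<bar>"
      unfolding that(6) by (metis dvd_imp_mod_0 mod_add_right_eq add.right_neutral)
    then show ?thesis using that assms(2) by simp
  qed
  fix ij kl
  assume *: "ij \<in> {0..<g} \<times> {0..<\<bar>q\<bar>} \<and> (\<exists>m n. X = fst ij + m * g + n * p \<and> Y = snd ij + n * q)"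
    "kl \<in> {0..<g} \<times> {0..<\<bar>q\<bar>} \<and> (\<exists>m n. X = fst kl + m * g + n * p \<and> Y = snd kl + n * q)"
  then obtain m n m' n' where "X = fst ij + m * g + n * p" "Y = snd ij + n * q"
    "X = fst kl + m' * g + n' * p" "Y = snd kl + n' * q" by blast
  with * coords[of "fst ij" "snd ij" m n] coords[of "fst kl" "snd kl" m' n'] show "ij = kl"
    by (auto simp: prod_eq_iff mem_Times_iff)
qed

text \<open>In a basis completing the primitive multiple of \<open>u\<close>, the two generators
  become \<open>(g, 0)\<close> and \<open>(p, q)\<close> with \<open>g * q\<close> equal to the
  determinant, which reduces the count to the triangular case.\<close>

lemma lattice_coset_reps:
  fixes u v :: "int^2"
  assumes "det2 u v \<noteq> 0"
  obtains R where "finite R" "card R = nat \<bar>det2 u v\<bar>"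
    "\<And>w. \<exists>!\<rho>. \<rho> \<in> R \<and> (\<exists>m n. w = \<rho> + m *s u + n *s v)"
proof -
  define g where "g = gcd (u$1) (u$2)"
  have "u$1 \<noteq> 0 \<or> u$2 \<noteq> 0" using assms by (auto simp: det2_def)
  then have g: "0 < g" by (auto simp: g_def)
  obtain a b where ab: "u$1 = g * a" "u$2 = g * b"
    unfolding g_def by (metis dvdE gcd_dvd1 gcd_dvd2)
  obtain s t where "s * u$1 + t * u$2 = g" unfolding g_def using bezout_int by blast
  then have "g * (s * a + t * b) = g * 1" unfolding ab by (simp add: algebra_simps)
  then have st: "s * a + t * b = 1" using g by (metis mult_cancel_left less_irrefl)
  text \<open>A basis of the integer lattice whose first vector is the primitive multiple of \<open>u\<close>.\<close>
  define vec :: "int \<times> int \<Rightarrow> int^2" where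
    "vec ij = vector [fst ij * a - snd ij * t, fst ij * b + snd ij * s]" for ij
  define X where "X w = w$1 * s + w$2 * t" for w :: "int^2"
  define Y where "Y w = a * w$2 - b * w$1" for w :: "int^2"
  have vecXY: "w = vec (X w, Y w)" for w
  proof -
    have "vec (X w, Y w) $ 1 = (s * a + t * b) * w$1" "vec (X w, Y w) $ 2 = (s * a + t * b) * w$2"
      by (simp_all add: vec_def X_def Y_def algebra_simps)
    then show ?thesis unfolding st by (simp add: vec_eq_iff forall_2)
  qed
  have XYvec: "X (vec ij) = fst ij" "Y (vec ij) = snd ij" for ij
  proof -
    have "X (vec ij) = (s * a + t * b) * fst ij" "Y (vec ij) = (s * a + t * b) * snd ij"
      by (simp_all add: vec_def X_def Y_def algebra_simps)
    then show "X (vec ij) = fst ij" "Y (vec ij) = snd ij" unfolding st by simp_all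
  qed
  have injvec: "inj vec" by (rule injI) (metis XYvec prod_eqI)
  define p q where "p = X v" and "q = Y v"
  have Xu: "X u = g" "Y u = 0"
  proof -
    have "X u = g * (s * a + t * b)" by (simp add: X_def ab algebra_simps)
    then show "X u = g" unfolding st by simp
    show "Y u = 0" by (simp add: Y_def ab algebra_simps)
  qed
  have det: "det2 u v = g * q" by (simp add: det2_def q_def Y_def ab algebra_simps)
  then have q: "q \<noteq> 0" using assms by auto
  have lin: "X (w + m *s u + n *s v) = X w + m * g + n * p" "Y (w + m *s u + n *s v) = Y w + n * q"
    for w m n
  proof -
    have "X (w + m *s u + n *s v) = X w + m * X u + n * X v" "Y (w + m *s u + n *s v) = Y w + m * Y u + n * Y v"
      by (simp_all add: X_def Y_def algebra_simps)
    then show "X (w + m *s u + n *s v) = X w + m * g + n * p" "Y (w + m *s u + n *s v) = Y w + n * q"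
      unfolding Xu p_def q_def by simp_all
  qed
  have eq_iff: "w = \<rho> + m *s u + n *s v \<longleftrightarrow> X w = X \<rho> + m * g + n * p \<and> Y w = Y \<rho> + n * q" for w \<rho> m n
    by (metis lin vecXY)
  define R where "R = vec ` ({0..<g} \<times> {0..<\<bar>q\<bar>})"
  have "finite R" by (simp add: R_def)
  moreover have "card R = nat \<bar>det2 u v\<bar>"
    unfolding R_def using injvec g
    by (subst card_image) (auto simp: det abs_mult nat_mult_distrib intro: inj_on_subset)
  moreover have "\<exists>!\<rho>. \<rho> \<in> R \<and> (\<exists>m n. w = \<rho> + m *s u + n *s v)" for w
  proof -
    obtain ij where ij: "ij \<in> {0..<g} \<times> {0..<\<bar>q\<bar>}"
      "\<exists>m n. X w = fst ij + m * g + n * p \<and> Y w = snd ij + n * q"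
      and uniq: "\<And>kl. kl \<in> {0..<g} \<times> {0..<\<bar>q\<bar>} \<Longrightarrow>
        \<exists>m n. X w = fst kl + m * g + n * p \<and> Y w = snd kl + n * q \<Longrightarrow> kl = ij"
      using triangular_lattice_reps[OF g q, of "X w" p "Y w"] by (elim ex1E) blast
    show ?thesis
    proof (rule ex1I[of _ "vec ij"])
      show "vec ij \<in> R \<and> (\<exists>m n. w = vec ij + m *s u + n *s v)"
        unfolding eq_iff XYvec using ij by (simp add: R_def)
    next
      fix \<rho> assume \<rho>: "\<rho> \<in> R \<and> (\<exists>m n. w = \<rho> + m *s u + n *s v)"
      then obtain kl where kl: "kl \<in> {0..<g} \<times> {0..<\<bar>q\<bar>}" "\<rho> = vec kl" by (auto simp: R_def)
      have "kl = ij" using \<rho> unfolding eq_iff kl(2) XYvec by (intro uniq kl) blast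
      then show "\<rho> = vec ij" using kl by simp
    qed
  qed
  ultimately show ?thesis using that by blast
qed

lemma torus_map_torus_of: "torus_map M (torus_of x) = torus_of (real_matrix M *v x)"
  by (simp add: torus_map.abs_eq)

lemma torus_map_inj:
  assumes "invertible M" shows "inj (torus_map M)"
proof -
  obtain B where "B ** M = mat 1" using assms by (auto simp: invertible_def)
  moreover have "real_matrix (B ** M) = real_matrix B ** real_matrix M"
    by (simp add: vec_eq_iff matrix_matrix_mult_def)
  moreover have "real_matrix (mat 1) = mat 1" by (simp add: vec_eq_iff mat_def)
  ultimately have 1: "real_matrix B ** real_matrix M = mat 1" by metis
  have "torus_map B (torus_map M p) = p" for p
  proof -
    obtain x where "p = torus_of x" by (rule torus_of_surj)
    then show ?thesis using 1 by (simp add: torus_map_torus_of matrix_vector_mul_assoc)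
  qed
  then show ?thesis by (metis injI)
qed

abbreviation real_vector :: "int^2 \<Rightarrow> real^2" where
  "real_vector z \<equiv> (\<chi> i. real_of_int (z $ i))"

lemma real_vector_inject: "real_vector u = real_vector v \<longleftrightarrow> u = v"
  by (simp add: vec_eq_iff)

lemma torus_of_add_int [simp]: "torus_of (x + real_vector z) = torus_of x"
  by (simp add: torus_of_eq_iff lattice_rel_def)

lemma torus_of_eq_obtain:
  assumes "torus_of x = torus_of y"
  obtains w where "x = y + real_vector w"
proof -
  have "\<forall>i. \<exists>n. x $ i - y $ i = of_int n" using assms by (auto simp: torus_of_eq_iff lattice_rel_def elim: Ints_cases)
  then obtain n where "\<And>i. x $ i - y $ i = of_int (n i)" by metis
  then have "x = y + real_vector (\<chi> i. n i)" by (simp add: vec_eq_iff algebra_simps)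
  then show ?thesis using that by blast
qed

section \<open>Eigenprojections and homoclinic points\<close>

locale toral_automorphism =
  fixes M :: "int^2^2"
  assumes invertible: "invertible M" and hyperbolic: "hyperbolic_matrix M" and trace_pos: "0 < trace M"

sublocale toral_automorphism \<subseteq> quadratic_unit "trace M" "det M"
  using det_unit hyperbolic_trace invertible hyperbolic trace_pos by unfold_locales auto

context toral_automorphism
begin

lemma lam_eq: "lam M = l"
  by (simp add: lam_def l_def discr_def)

lemma compactum_eq: "compactum M = {\<epsilon>. admissible \<epsilon>}"
  by (simp add: compactum_def admissible_def Let_def)

lemma trace_det: "trace M = M$1$1 + M$2$2" "det M = M$1$1 * M$2$2 - M$1$2 * M$2$1"
  by (simp_all add: trace_def sum_2 det_2)

definition act :: "real^2 \<Rightarrow> real^2" where "act v = real_matrix M *v v"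

lemma act_nth: "act v $ 1 = M$1$1 * v$1 + M$1$2 * v$2" "act v $ 2 = M$2$1 * v$1 + M$2$2 * v$2"
  by (simp_all add: act_def matrix_vector_mult_def sum_2)

lemma mult_nth: "(M *v z) $ 1 = M$1$1 * z$1 + M$1$2 * z$2" "(M *v z) $ 2 = M$2$1 * z$1 + M$2$2 * z$2"
  by (simp_all add: matrix_vector_mult_def sum_2)

lemma act_act: "act (act v) = trace M *\<^sub>R act v - det M *\<^sub>R v"
  by (simp add: vec_eq_iff forall_2 act_nth trace_det algebra_simps)

lemma act_linear: "act (v + w) = act v + act w" "act (v - w) = act v - act w" "act (c *\<^sub>R v) = c *\<^sub>R act v"
  by (simp_all add: vec_eq_iff forall_2 act_nth algebra_simps)

lemma act_real_vector: "act (real_vector z) = real_vector (M *v z)"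
  by (simp add: act_def int_matrix_mult_vec)

text \<open>Lagrange interpolation in \<open>M\<close>: the spectral projections come without a
  choice of eigenvectors, and their properties follow from Cayley-Hamilton
  (\<open>act_act\<close>).\<close>

definition Pu :: "real^2 \<Rightarrow> real^2" where "Pu v = (1 / (l - lc)) *\<^sub>R (act v - lc *\<^sub>R v)"
definition Ps :: "real^2 \<Rightarrow> real^2" where "Ps v = (1 / (l - lc)) *\<^sub>R (l *\<^sub>R v - act v)"

lemma Pu_linear: "Pu (v + w) = Pu v + Pu w" "Pu (v - w) = Pu v - Pu w" "Pu (c *\<^sub>R v) = c *\<^sub>R Pu v"
  by (simp_all add: Pu_def act_linear algebra_simps)

lemma Pu_add_Ps: "Pu v + Ps v = v"
proof -
  have "Pu v + Ps v = (1 / (l - lc)) *\<^sub>R ((l - lc) *\<^sub>R v)"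
    by (simp add: Pu_def Ps_def algebra_simps)
  then show ?thesis using l_diff_pos by simp
qed

lemma Pu_act: "Pu (act v) = l *\<^sub>R Pu v"
proof -
  have "act (act v) - lc *\<^sub>R act v = l *\<^sub>R (act v - lc *\<^sub>R v)"
    unfolding act_act l_add[symmetric] l_mult[symmetric] by (simp add: algebra_simps)
  then show ?thesis by (simp add: Pu_def)
qed

lemma Ps_act: "Ps (act v) = lc *\<^sub>R Ps v"
proof -
  have "l *\<^sub>R act v - act (act v) = lc *\<^sub>R (l *\<^sub>R v - act v)"
    unfolding act_act l_add[symmetric] l_mult[symmetric] by (simp add: algebra_simps)
  then show ?thesis by (simp add: Ps_def)
qed

lemma act_Pu: "act (Pu v) = l *\<^sub>R Pu v"
  by (metis Pu_act Pu_def act_linear(2,3) Pu_linear(2,3))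

lemma Pu_eigen: "act t = l *\<^sub>R t \<Longrightarrow> Pu t = t"
  using l_diff_pos by (simp add: Pu_def flip: scaleR_left_diff_distrib)

lemma discr_mult_square:
  fixes n k :: int
  assumes "((trace M)\<^sup>2 - 4 * det M) * n\<^sup>2 = k\<^sup>2" shows "n = 0"
  using discr_not_square[OF _ assms] sigma_cases r_pos r_ge_3 by blast

definition index :: "int^2 \<Rightarrow> int" where "index z = det2 z (M *v z)"

text \<open>\<open>index\<close> is a binary quadratic form whose discriminant is that of the
  characteristic polynomial. Completing the square shows that a nontrivial zero would make this
  discriminant a rational square.\<close>

lemma index_nonzero:
  assumes "z \<noteq> 0" shows "index z \<noteq> 0"
proof
  assume "index z = 0"
  define a b c d where "a = M$1$1" and "b = M$1$2" and "c = M$2$1" and "d = M$2$2"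
  have disc: "(trace M)\<^sup>2 - 4 * det M = (d - a)\<^sup>2 + 4 * b * c"
    by (simp add: trace_det a_def b_def c_def d_def power2_eq_square algebra_simps)
  have form: "c * (z$1)\<^sup>2 + (d - a) * z$1 * z$2 - b * (z$2)\<^sup>2 = 0"
    using \<open>index z = 0\<close> by (simp add: index_def det2_def mult_nth a_def b_def c_def d_def power2_eq_square algebra_simps)
  have "(2 * c * z$1 + (d - a) * z$2)\<^sup>2 =
      4 * c * (c * (z$1)\<^sup>2 + (d - a) * z$1 * z$2 - b * (z$2)\<^sup>2) + ((d - a)\<^sup>2 + 4 * b * c) * (z$2)\<^sup>2"
    by (simp add: power2_eq_square algebra_simps)
  then have z2: "z$2 = 0"
    unfolding form by (intro discr_mult_square[of "z$2" "2 * c * z$1 + (d - a) * z$2"]) (simp add: disc)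
  then have "z$1 \<noteq> 0" using assms by (auto simp: vec_eq_iff forall_2)
  then have "c = 0" using form z2 by simp
  then have "((trace M)\<^sup>2 - 4 * det M) * 1\<^sup>2 = (d - a)\<^sup>2" unfolding disc by simp
  from discr_mult_square[OF this] show False by simp
qed

lemma Pu_real_vector_nonzero:
  assumes "z \<noteq> 0" shows "Pu (real_vector z) \<noteq> 0"
proof
  assume "Pu (real_vector z) = 0"
  then have "act (real_vector z) = lc *\<^sub>R real_vector z" using l_diff_pos by (simp add: Pu_def)
  then have e: "(M *v z) $ 1 = lc * z$1" "(M *v z) $ 2 = lc * z$2"
    unfolding act_real_vector by (simp_all add: vec_eq_iff)
  have "real_of_int (index z) = of_int (z$1) * of_int ((M *v z) $ 2) - of_int (z$2) * of_int ((M *v z) $ 1)"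
    by (simp add: index_def det2_def)
  then have "real_of_int (index z) = 0" unfolding e by simp
  then show False using index_nonzero[OF assms] by simp
qed

text \<open>The inverse of \<open>M\<close> is \<open>det M\<close> times
  \<open>trace M - M\<close>, an integer matrix, so the projected lattice is stable under division
  by \<open>l\<close>.\<close>

lemma Pu_real_vector_divide_l:
  "(1 / l) *\<^sub>R Pu (real_vector z) = Pu (real_vector (det M *s (trace M *s z - M *v z)))"
proof -
  have eq: "real_vector (det M *s (trace M *s z - M *v z))
      = det M *\<^sub>R (trace M *\<^sub>R real_vector z - act (real_vector z))"
    unfolding act_real_vector by (simp add: vec_eq_iff algebra_simps)
  have "Pu (real_vector (det M *s (trace M *s z - M *v z))) = (det M * (trace M - l)) *\<^sub>R Pu (real_vector z)"
    unfolding eq by (simp add: Pu_linear Pu_act algebra_simps)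
  also have "det M * (trace M - l) = 1 / l" unfolding inverse_l by (simp add: lc_eq)
  finally show ?thesis by simp
qed

lemma Pu_real_vector_divide_l_power:
  "\<exists>z'. (1 / l) ^ n *\<^sub>R Pu (real_vector z) = Pu (real_vector z')"
proof (induction n)
  case 0
  show ?case by auto
next
  case (Suc n)
  then obtain z' where "(1 / l) ^ n *\<^sub>R Pu (real_vector z) = Pu (real_vector z')" by blast
  then have "(1 / l) ^ Suc n *\<^sub>R Pu (real_vector z) = (1 / l) *\<^sub>R Pu (real_vector z')"
    by (metis power_Suc scaleR_scaleR)
  then show ?case unfolding Pu_real_vector_divide_l by blast
qed

lemma torus_map_power_eigen:
  assumes "act t = l *\<^sub>R t"
  shows "(torus_map M ^^ n) (torus_of t) = torus_of (l ^ n *\<^sub>R t)"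
proof (induction n)
  case (Suc n)
  have "act (l ^ n *\<^sub>R t) = l ^ Suc n *\<^sub>R t" using assms by (simp add: act_linear)
  then show ?case using Suc by (simp add: torus_map_torus_of act_def)
qed simp

lemma torus_map_inv_power_eigen:
  assumes "act t = l *\<^sub>R t"
  shows "(inv (torus_map M) ^^ n) (torus_of t) = torus_of ((1 / l) ^ n *\<^sub>R t)"
proof (induction n)
  case (Suc n)
  have "act ((1 / l) ^ Suc n *\<^sub>R t) = (1 / l) ^ n *\<^sub>R t" using assms l_pos by (simp add: act_linear)
  then have "torus_map M (torus_of ((1 / l) ^ Suc n *\<^sub>R t)) = torus_of ((1 / l) ^ n *\<^sub>R t)"
    by (simp add: torus_map_torus_of act_def)
  then have "inv (torus_map M) (torus_of ((1 / l) ^ n *\<^sub>R t)) = torus_of ((1 / l) ^ Suc n *\<^sub>R t)"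
    using torus_map_inj[OF invertible] by (metis inv_f_f)
  then show ?case using Suc by simp
qed simp

text \<open>The sum is \<open>M\<close> to the power \<open>n\<close> applied to \<open>z\<close>.
  Modulo integer vectors, the growing \<open>l ^ n *\<^sub>R Pu z\<close> may thus be replaced by
  the decaying \<open>- lc ^ n *\<^sub>R Ps z\<close>.\<close>

lemma eigen_power_sum_integral: "\<exists>w. l ^ n *\<^sub>R Pu (real_vector z) + lc ^ n *\<^sub>R Ps (real_vector z) = real_vector w"
proof (induction n arbitrary: z)
  case 0
  show ?case by (auto simp: Pu_add_Ps)
next
  case (Suc n)
  have "l ^ Suc n *\<^sub>R Pu (real_vector z) + lc ^ Suc n *\<^sub>R Ps (real_vector z)
      = l ^ n *\<^sub>R Pu (real_vector (M *v z)) + lc ^ n *\<^sub>R Ps (real_vector (M *v z))"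
    by (simp add: act_real_vector[symmetric] Pu_act Ps_act mult.commute)
  then show ?case using Suc[of "M *v z"] by simp
qed

lemma homoclinic_lift_Pu:
  assumes "z \<noteq> 0" shows "homoclinic_lift M (Pu (real_vector z))"
proof -
  have eig: "act (Pu (real_vector z)) = l *\<^sub>R Pu (real_vector z)" by (rule act_Pu)
  have "torus_of (l ^ n *\<^sub>R Pu (real_vector z)) = torus_of (- (lc ^ n *\<^sub>R Ps (real_vector z)))" for n
  proof -
    obtain w where "l ^ n *\<^sub>R Pu (real_vector z) + lc ^ n *\<^sub>R Ps (real_vector z) = real_vector w"
      using eigen_power_sum_integral by blast
    then have "l ^ n *\<^sub>R Pu (real_vector z) = - (lc ^ n *\<^sub>R Ps (real_vector z)) + real_vector w"
      by (simp add: algebra_simps)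
    then show ?thesis by (simp only: torus_of_add_int)
  qed
  moreover have "(\<lambda>n. torus_of (- (lc ^ n *\<^sub>R Ps (real_vector z)))) \<longlonglongrightarrow> torus_of (- (0 *\<^sub>R Ps (real_vector z)))"
    using abs_lc_less_1 by (intro tendsto_torus_of tendsto_intros LIMSEQ_power_zero) simp
  ultimately have "(\<lambda>n. (torus_map M ^^ n) (torus_of (Pu (real_vector z)))) \<longlonglongrightarrow> torus_of 0"
    by (simp add: torus_map_power_eigen[OF eig])
  moreover have "(\<lambda>n. torus_of ((1 / l) ^ n *\<^sub>R Pu (real_vector z))) \<longlonglongrightarrow> torus_of (0 *\<^sub>R Pu (real_vector z))"
    using l_gt_1 by (intro tendsto_torus_of tendsto_intros LIMSEQ_power_zero) simp
  then have "(\<lambda>n. (inv (torus_map M) ^^ n) (torus_of (Pu (real_vector z)))) \<longlonglongrightarrow> torus_of 0"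
    by (simp add: torus_map_inv_power_eigen[OF eig])
  ultimately show ?thesis
    unfolding homoclinic_lift_def homoclinic_def
    using eig Pu_real_vector_nonzero[OF assms] by (simp add: act_def lam_eq)
qed

text \<open>The multiples \<open>\<lambda>\<^sup>n t\<close> come close to integer vectors; being nearly mapped to each other by \<open>M\<close>,
  these eventually form an orbit, so the error vectors form a bounded orbit and lie on the
  contracting eigenline.\<close>

lemma homoclinic_lift_imp_Pu:
  assumes "homoclinic_lift M t"
  obtains z where "z \<noteq> 0" "t = Pu (real_vector z)"
proof -
  have t: "t \<noteq> 0" "act t = l *\<^sub>R t" "(\<lambda>n. (torus_map M ^^ n) (torus_of t)) \<longlonglongrightarrow> torus_of 0"
    using assms by (simp_all add: homoclinic_lift_def homoclinic_def act_def lam_eq)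
  have "linear act" by (rule linearI) (simp_all add: act_linear)
  then have bl: "bounded_linear act" by (simp add: linear_conv_bounded_linear)
  obtain L where L: "0 < L" "\<And>v. norm (act v) \<le> norm v * L"
    using bounded_linear.pos_bounded[OF bl] by blast
  \<comment> \<open>With \<open>e * L + e < 1\<close>, the integer vectors \<open>M *v z n\<close>
    and \<open>z (Suc n)\<close> differ by less than 1 in each coordinate, so they coincide.\<close>
  define e where "e = 1 / (2 * (L + 1))"
  have e: "0 < e" "e * L + e < 1" using L(1) by (simp_all add: e_def field_simps)
  have "\<forall>\<^sub>F n in sequentially. \<exists>w. (\<forall>i. w $ i \<in> \<int>) \<and> norm (l ^ n *\<^sub>R t - w) < e"
    using t(3) e(1) unfolding torus_map_power_eigen[OF t(2)] by (rule tendsto_torus_of_zero)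
  then obtain N where N: "\<And>n. N \<le> n \<Longrightarrow> \<exists>w. (\<forall>i. w $ i \<in> \<int>) \<and> norm (l ^ n *\<^sub>R t - w) < e"
    unfolding eventually_sequentially by blast
  have "\<exists>z. norm (l ^ n *\<^sub>R t - real_vector z) < e" if n: "N \<le> n" for n
  proof -
    obtain w where w: "\<forall>i. w $ i \<in> \<int>" "norm (l ^ n *\<^sub>R t - w) < e" using N[OF n] by blast
    then have "w = real_vector (\<chi> i. \<lfloor>w $ i\<rfloor>)" by (simp add: vec_eq_iff)
    then show ?thesis using w(2) by metis
  qed
  then obtain z where z: "\<And>n. N \<le> n \<Longrightarrow> norm (l ^ n *\<^sub>R t - real_vector (z n)) < e" by metis
  define err where "err n = l ^ n *\<^sub>R t - real_vector (z n)" for n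
  have err: "norm (err n) < e" if "N \<le> n" for n using z[OF that] by (simp add: err_def)
  have step: "err (Suc n) = act (err n)" if n: "N \<le> n" for n
  proof -
    have lt: "act (l ^ n *\<^sub>R t) = l ^ Suc n *\<^sub>R t" using t(2) by (simp add: act_linear)
    have diff: "err (Suc n) - act (err n) = real_vector (M *v z n) - real_vector (z (Suc n))"
      unfolding err_def act_linear(2) lt act_real_vector by simp
    have "norm (act (err n)) \<le> e * L"
      using L(2)[of "err n"] err[OF n] L(1) by (smt (verit) mult_right_mono)
    then have small: "norm (err (Suc n) - act (err n)) < 1"
      using norm_triangle_ineq4[of "err (Suc n)" "act (err n)"] err[of "Suc n"] n e(2) by simp
    have "(M *v z n) $ i = z (Suc n) $ i" for i
    proof -
      have "\<bar>real_of_int ((M *v z n) $ i) - real_of_int (z (Suc n) $ i)\<bar> < 1"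
        using small component_le_norm_cart[of "err (Suc n) - act (err n)" i] unfolding diff by simp
      then show ?thesis by linarith
    qed
    then show ?thesis using diff by (simp add: vec_eq_iff)
  qed
  have "Pu (err (N + k)) = l ^ k *\<^sub>R Pu (err N)" for k
    by (induction k) (simp_all add: step Pu_act)
  moreover have "norm (Pu v) \<le> (L + \<bar>lc\<bar>) / (l - lc) * norm v" for v
  proof -
    have "norm (act v - lc *\<^sub>R v) \<le> (L + \<bar>lc\<bar>) * norm v"
      using norm_triangle_ineq4[of "act v" "lc *\<^sub>R v"] L(2)[of v] by (simp add: algebra_simps)
    then show ?thesis using l_diff_pos by (simp add: Pu_def divide_right_mono)
  qed
  then have "norm (Pu (err (N + k))) \<le> (L + \<bar>lc\<bar>) / (l - lc) * e" for k
    using err[of "N + k"] L(1) l_diff_pos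
    by (smt (verit) divide_nonneg_pos le_add1 mult_left_mono abs_ge_zero)
  ultimately have bd: "l ^ k * norm (Pu (err N)) \<le> (L + \<bar>lc\<bar>) / (l - lc) * e" for k
    using l_pos by (metis abs_of_pos norm_scaleR zero_less_power)
  have "Pu (err N) = 0"
  proof (rule ccontr)
    assume "Pu (err N) \<noteq> 0"
    then have pos: "0 < norm (Pu (err N))" by simp
    obtain k where "(L + \<bar>lc\<bar>) / (l - lc) * e / norm (Pu (err N)) < l ^ k"
      using real_arch_pow[OF l_gt_1] by blast
    then have "(L + \<bar>lc\<bar>) / (l - lc) * e < l ^ k * norm (Pu (err N))"
      using pos by (simp only: pos_divide_less_eq)
    then show False using bd[of k] by simp
  qed
  moreover have "Pu (l ^ N *\<^sub>R t) = l ^ N *\<^sub>R t" using Pu_eigen[OF t(2)] by (simp add: Pu_linear)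
  ultimately have "l ^ N *\<^sub>R t = Pu (real_vector (z N))" by (simp add: err_def Pu_linear)
  then have "(1 / l) ^ N *\<^sub>R Pu (real_vector (z N)) = (1 / l) ^ N *\<^sub>R l ^ N *\<^sub>R t" by simp
  also have "\<dots> = t" using l_pos by (simp flip: power_mult_distrib)
  finally obtain z' where z': "t = Pu (real_vector z')"
    using Pu_real_vector_divide_l_power by metis
  moreover have "z' \<noteq> 0"
  proof
    assume "z' = 0"
    then have "Pu (real_vector z') = Pu (0 *\<^sub>R 0)" by (simp add: zero_vec_def)
    then show False using z' t(1) by (simp only: Pu_linear) simp
  qed
  ultimately show ?thesis using that by blast
qed


subsection \<open>Counting preimages\<close>

text \<open>By Cramer's rule this is \<open>c1 + c2 * t\<close> for \<open>v = c1 z + c2 Mz\<close>.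
  At \<open>t = l\<close> and \<open>t = lc\<close> it gives the coefficients of \<open>v\<close>
  along \<open>Pu z\<close> and \<open>Ps z\<close>.\<close>

definition coord :: "int^2 \<Rightarrow> real \<Rightarrow> real^2 \<Rightarrow> real" where
  "coord z t v = (v$1 * (M *v z) $ 2 - v$2 * (M *v z) $ 1 + (z$1 * v$2 - z$2 * v$1) * t) / index z"

lemma coord_linear:
  "coord z t (v + w) = coord z t v + coord z t w" "coord z t (v - w) = coord z t v - coord z t w"
  "coord z t (c *\<^sub>R v) = c * coord z t v"
  by (simp_all add: coord_def algebra_simps add_divide_distrib diff_divide_distrib)

lemma coord_basis:
  assumes "z \<noteq> 0"
  shows "coord z t (real_vector z) = 1" "coord z t (real_vector (M *v z)) = t"
proof -
  have i: "real_of_int (index z) = of_int (z$1) * of_int ((M *v z) $ 2) - of_int (z$2) * of_int ((M *v z) $ 1)"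
    by (simp add: index_def det2_def)
  have "real_of_int (index z) \<noteq> 0" using index_nonzero[OF assms] by simp
  then show "coord z t (real_vector z) = 1" "coord z t (real_vector (M *v z)) = t"
    unfolding coord_def i by (simp_all add: divide_simps)
qed

lemma coord_Pu_Ps:
  assumes "z \<noteq> 0"
  shows "coord z l (Pu (real_vector z)) = 1" "coord z lc (Pu (real_vector z)) = 0"
    "coord z l (Ps (real_vector z)) = 0" "coord z lc (Ps (real_vector z)) = 1"
  using l_diff_pos by (simp_all add: Pu_def Ps_def act_real_vector coord_linear coord_basis[OF assms])

lemma coord_expand:
  assumes "z \<noteq> 0"
  shows "v = coord z l v *\<^sub>R Pu (real_vector z) + coord z lc v *\<^sub>R Ps (real_vector z)"
proof -
  define c1 where "c1 = (v$1 * (M *v z) $ 2 - v$2 * (M *v z) $ 1) / index z"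
  define c2 where "c2 = (z$1 * v$2 - z$2 * v$1) / index z"
  have i: "real_of_int (index z) = of_int (z$1) * of_int ((M *v z) $ 2) - of_int (z$2) * of_int ((M *v z) $ 1)"
    by (simp add: index_def det2_def)
  have i0: "real_of_int (index z) \<noteq> 0" using index_nonzero[OF assms] by simp
  have "index z *\<^sub>R (c1 *\<^sub>R real_vector z + c2 *\<^sub>R real_vector (M *v z)) = index z *\<^sub>R v"
  proof -
    have "index z * c1 = v$1 * (M *v z) $ 2 - v$2 * (M *v z) $ 1" "index z * c2 = z$1 * v$2 - z$2 * v$1"
      using i0 by (simp_all add: c1_def c2_def)
    then have "index z *\<^sub>R (c1 *\<^sub>R real_vector z + c2 *\<^sub>R real_vector (M *v z)) =
        (v$1 * (M *v z) $ 2 - v$2 * (M *v z) $ 1) *\<^sub>R real_vector z + (z$1 * v$2 - z$2 * v$1) *\<^sub>R real_vector (M *v z)"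
      by (simp add: scaleR_add_right)
    also have "\<dots> = index z *\<^sub>R v"
      unfolding i by (simp add: vec_eq_iff forall_2 algebra_simps)
    finally show ?thesis .
  qed
  then have v: "v = c1 *\<^sub>R real_vector z + c2 *\<^sub>R real_vector (M *v z)"
    using i0 by simp
  have z: "real_vector z = Pu (real_vector z) + Ps (real_vector z)"
    by (simp add: Pu_add_Ps)
  have "real_vector (M *v z) = Pu (real_vector (M *v z)) + Ps (real_vector (M *v z))"
    by (simp add: Pu_add_Ps)
  then have Mz: "real_vector (M *v z) = l *\<^sub>R Pu (real_vector z) + lc *\<^sub>R Ps (real_vector z)"
    unfolding act_real_vector[symmetric] Pu_act Ps_act .
  have coord: "coord z t v = c1 + c2 * t" for t
    by (simp add: coord_def c1_def c2_def add_divide_distrib)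
  have "v = c1 *\<^sub>R (Pu (real_vector z) + Ps (real_vector z))
      + c2 *\<^sub>R (l *\<^sub>R Pu (real_vector z) + lc *\<^sub>R Ps (real_vector z))"
    using v z Mz by metis
  then show ?thesis unfolding coord by (simp add: algebra_simps)
qed

text \<open>Quantifying over all integer translates makes this a property of the torus
  point.\<close>

definition regular :: "int^2 \<Rightarrow> real^2 \<Rightarrow> bool" where
  "regular z v \<longleftrightarrow> (\<forall>w. generic (coord z l (v + real_vector w)) \<and> generic (coord z lc (v + real_vector w)))"

lemma coord_level_set:
  assumes "z \<noteq> 0"
  shows "closed {v. coord z t (v + w) = c}" "negligible {v. coord z t (v + w) = c}"
proof -
  define a :: "real^2" where
    "a = vector [((M *v z) $ 2 - z$2 * t) / index z, (z$1 * t - (M *v z) $ 1) / index z]"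
  have inner: "coord z t v = a \<bullet> v" for v
    by (simp add: coord_def a_def inner_vec_def sum_2 add_divide_distrib diff_divide_distrib algebra_simps)
  have "a \<noteq> 0"
    using coord_basis(1)[OF assms, of t] unfolding inner by auto
  have "coord z t (v + w) = c \<longleftrightarrow> a \<bullet> v = c - a \<bullet> w" for v
    unfolding inner by (auto simp: inner_add_right)
  then have "{v. coord z t (v + w) = c} = {v. a \<bullet> v = c - a \<bullet> w}" by simp
  then show "closed {v. coord z t (v + w) = c}" "negligible {v. coord z t (v + w) = c}"
    using closed_hyperplane[of a] negligible_hyperplane \<open>a \<noteq> 0\<close> by auto
qed

text \<open>Nonregular vectors fill countably many lines, one for each eigencoordinate, integer
  translate and element of Z[\<lambda>].\<close>

lemma AE_regular:
  assumes "z \<noteq> 0"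
  shows "AE p in torus_lebesgue. \<exists>v. p = torus_of v \<and> regular z v"
proof -
  define S where "S = (\<lambda>(t, w :: int^2, p :: int, q :: int).
    {v. coord z t (v + real_vector w) = p + q * l})"
  define F where "F = S ` ({l, lc} \<times> UNIV)"
  have countable: "countable F" unfolding F_def by (intro countable_image countable_SIGMA) auto
  have "v \<in> \<Union>F \<longleftrightarrow> \<not> regular z v" for v
  proof
    assume "v \<in> \<Union>F"
    then obtain t w p q where "t = l \<or> t = lc" "coord z t (v + real_vector w) = of_int p + of_int q * l"
      by (auto simp: F_def S_def)
    then show "\<not> regular z v" unfolding regular_def generic_def by blast
  next
    assume "\<not> regular z v"
    then obtain w t p q where *: "t \<in> {l, lc}" "coord z t (v + real_vector w) = of_int p + of_int q * l"
      unfolding regular_def generic_def by blast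
    have "v \<in> S (t, w, p, q)" using * by (simp add: S_def)
    moreover have "S (t, w, p, q) \<in> F" using *(1) by (auto simp: F_def)
    ultimately show "v \<in> \<Union>F" by blast
  qed
  note F = this
  have "regular z v" if vw: "lattice_rel v w" "regular z w" for v w
  proof -
    obtain u where "v = w + real_vector u"
      using torus_of_eq_obtain[OF vw(1)[folded torus_of_eq_iff]] .
    then have "v + real_vector w' = w + real_vector (u + w')" for w'
      by (simp add: vec_eq_iff)
    then show ?thesis using vw(2) unfolding regular_def by metis
  qed
  then have inv: "w \<in> \<Union>F" if "lattice_rel v w" "v \<in> \<Union>F" for v w
    using that unfolding F by blast
  have level: "closed T \<and> negligible T" if "T \<in> F" for T
    using that coord_level_set[OF assms] by (auto simp: F_def S_def)
  have "AE p in torus_lebesgue. p \<notin> torus_of ` \<Union>F"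
    by (rule AE_torus_lebesgue[OF countable level inv])
  then show ?thesis
  proof eventually_elim
    case (elim p)
    obtain v where "p = torus_of v" by (rule torus_of_surj)
    then show ?case using elim F by blast
  qed
qed

definition code :: "int^2 \<Rightarrow> (int \<Rightarrow> int) \<Rightarrow> torus" where
  "code z \<epsilon> = torus_of (future \<epsilon> 0 *\<^sub>R Pu (real_vector z) - past \<epsilon> 0 *\<^sub>R Ps (real_vector z))"

text \<open>The second sum has growing powers and gets replaced by its conjugate. The unsimplified
  indices match the unfolded \<open>future\<close> and \<open>past\<close> at 0.\<close>

lemma symmetric_sum_split:
  "(\<Sum>n = - int N..int N. of_int (\<epsilon> n) * l powi (- n)) =
    (\<Sum>k<N. (\<epsilon> (0 + 1 + int k) / l) * (1 / l) ^ k) + (\<Sum>k<Suc N. \<epsilon> (0 - int k) * l ^ k)"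
proof (induction N)
  case (Suc N)
  have "{- int (Suc N)..int (Suc N)} = insert (- int (Suc N)) (insert (int (Suc N)) {- int N..int N})"
    by auto
  then have "(\<Sum>n = - int (Suc N)..int (Suc N). of_int (\<epsilon> n) * l powi (- n)) =
      of_int (\<epsilon> (- int (Suc N))) * l powi (int (Suc N)) + of_int (\<epsilon> (int (Suc N))) * l powi (- int (Suc N))
      + (\<Sum>n = - int N..int N. of_int (\<epsilon> n) * l powi (- n))"
    by (simp del: of_nat_Suc)
  also have "l powi (int (Suc N)) = l ^ Suc N" by (rule power_int_of_nat)
  also have "l powi (- int (Suc N)) = (1 / l) * (1 / l) ^ N"
    unfolding power_int_minus power_int_of_nat by (simp add: field_simps)
  finally show ?case unfolding Suc by (simp add: algebra_simps)
qed simp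

text \<open>The half with powers \<open>l ^ k\<close> need not converge in the plane; by
  \<open>eigen_power_sum_integral\<close>, each of its terms is exchanged modulo integer vectors for
  one with \<open>- lc ^ k\<close> along \<open>Ps z\<close>.\<close>

lemma code_tendsto:
  assumes "admissible \<epsilon>"
  shows "(\<lambda>N. torus_of ((\<Sum>n = - int N..int N. of_int (\<epsilon> n) * lam M powi (- n)) *\<^sub>R Pu (real_vector z)))
    \<longlonglongrightarrow> code z \<epsilon>"
proof -
  let ?u = "Pu (real_vector z)" and ?s = "Ps (real_vector z)"
  let ?f = "\<lambda>N. \<Sum>k<N. (\<epsilon> (0 + 1 + int k) / l) * (1 / l) ^ k"
  let ?p = "\<lambda>N. \<Sum>k<Suc N. \<epsilon> (0 - int k) * lc ^ k"
  have integral: "\<exists>w. (\<Sum>k<n. \<epsilon> (0 - int k) * l ^ k) *\<^sub>R ?u + (\<Sum>k<n. \<epsilon> (0 - int k) * lc ^ k) *\<^sub>R ?s = real_vector w" for n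
  proof (induction n)
    case 0
    show ?case by (intro exI[of _ 0]) (simp add: vec_eq_iff)
  next
    case (Suc n)
    obtain w where w: "l ^ n *\<^sub>R ?u + lc ^ n *\<^sub>R ?s = real_vector w" using eigen_power_sum_integral by blast
    obtain w' where w': "(\<Sum>k<n. \<epsilon> (0 - int k) * l ^ k) *\<^sub>R ?u + (\<Sum>k<n. \<epsilon> (0 - int k) * lc ^ k) *\<^sub>R ?s = real_vector w'"
      using Suc by blast
    have "(\<Sum>k<Suc n. \<epsilon> (0 - int k) * l ^ k) *\<^sub>R ?u + (\<Sum>k<Suc n. \<epsilon> (0 - int k) * lc ^ k) *\<^sub>R ?s
        = real_vector w' + \<epsilon> (0 - int n) *\<^sub>R real_vector w"
      unfolding w[symmetric] w'[symmetric] by (simp add: algebra_simps)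
    also have "\<dots> = real_vector (w' + \<epsilon> (0 - int n) *s w)" by (simp add: vec_eq_iff)
    finally show ?case by blast
  qed
  have eq: "torus_of ((\<Sum>n = - int N..int N. of_int (\<epsilon> n) * lam M powi (- n)) *\<^sub>R ?u) = torus_of (?f N *\<^sub>R ?u - ?p N *\<^sub>R ?s)" for N
  proof -
    obtain w where "(\<Sum>k<Suc N. \<epsilon> (0 - int k) * l ^ k) *\<^sub>R ?u + ?p N *\<^sub>R ?s = real_vector w" using integral by blast
    then have A: "(\<Sum>k<Suc N. \<epsilon> (0 - int k) * l ^ k) *\<^sub>R ?u = real_vector w - ?p N *\<^sub>R ?s"
      by (simp only: eq_diff_eq)
    have "(\<Sum>n = - int N..int N. of_int (\<epsilon> n) * lam M powi (- n)) *\<^sub>R ?u = (?f N *\<^sub>R ?u - ?p N *\<^sub>R ?s) + real_vector w"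
      unfolding lam_eq symmetric_sum_split scaleR_left_distrib A by simp
    then show ?thesis by (simp only: torus_of_add_int)
  qed
  have f: "?f \<longlonglongrightarrow> future \<epsilon> 0"
    unfolding future_def by (rule summable_LIMSEQ[OF future_summable[OF assms]])
  have p: "?p \<longlonglongrightarrow> past \<epsilon> 0"
    unfolding past_def by (rule LIMSEQ_Suc[OF summable_LIMSEQ[OF past_summable[OF assms]]])
  show ?thesis unfolding eq code_def by (intro tendsto_torus_of tendsto_intros f p)
qed

lemma is_coding_by_code: "is_coding_by M (Pu (real_vector z)) (code z)"
  unfolding is_coding_by_def compactum_eq using code_tendsto by blast

lemma is_coding_by_imp_code:
  assumes "is_coding_by M (Pu (real_vector z)) \<phi>" "admissible \<epsilon>"
  shows "\<phi> \<epsilon> = code z \<epsilon>"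
  using assms LIMSEQ_unique[OF _ code_tendsto[OF assms(2)]]
  unfolding is_coding_by_def compactum_eq by blast

lemma generic_minus: "generic x \<Longrightarrow> generic (- x)"
  unfolding generic_def
proof (intro allI notI)
  fix p q :: int
  assume *: "\<forall>(p::int) (q::int). x \<noteq> p + q * l" and "- x = p + q * l"
  then have "x = of_int (- p) + of_int (- q) * l" by simp
  with * show False by blast
qed

text \<open>Each coset of \<open>\<int>z + \<int>Mz\<close> in \<open>\<int>\<^sup>2\<close> accounts for exactly one preimage of a regular point.\<close>

lemma card_code_preimage:
  assumes z: "z \<noteq> 0" and reg: "regular z v"
  shows "finite {\<epsilon>. admissible \<epsilon> \<and> code z \<epsilon> = torus_of v}"
    and "card {\<epsilon>. admissible \<epsilon> \<and> code z \<epsilon> = torus_of v} = nat \<bar>index z\<bar>"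
proof -
  let ?u = "Pu (real_vector z)" and ?s = "Ps (real_vector z)"
  have det: "det2 z (M *v z) \<noteq> 0" using index_nonzero[OF z] by (simp add: index_def)
  have "\<exists>R. finite R \<and> card R = nat \<bar>index z\<bar> \<and>
      (\<forall>w. \<exists>!\<rho>. \<rho> \<in> R \<and> (\<exists>m n. w = \<rho> + m *s z + n *s (M *v z)))"
    by (rule lattice_coset_reps[OF det, folded index_def]) blast
  then obtain R where R: "finite R" "card R = nat \<bar>index z\<bar>"
    "\<And>w. \<exists>!\<rho>. \<rho> \<in> R \<and> (\<exists>m n. w = \<rho> + m *s z + n *s (M *v z))"
    by auto
  \<comment> \<open>These are the codes of \<open>v + \<rho>\<close> modulo Z[\<lambda>]; the signs
    at \<open>past\<close> reflect the minus sign in \<open>code\<close>.\<close>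
  define codes where "codes \<rho> \<epsilon> \<longleftrightarrow> admissible \<epsilon> \<and> (\<exists>(p::int) (q::int).
    future \<epsilon> 0 = coord z l (v + real_vector \<rho>) + (p + q * l) \<and>
    past \<epsilon> 0 = - coord z lc (v + real_vector \<rho>) - (p + q * lc))" for \<rho> \<epsilon>
  have gen: "generic (coord z l (v + real_vector \<rho>))" "generic (- coord z lc (v + real_vector \<rho>))" for \<rho>
    using reg generic_minus by (simp_all add: regular_def)
  have ex: "\<exists>\<epsilon>. codes \<rho> \<epsilon>" for \<rho>
    using code_exists[OF gen[of \<rho>]] unfolding codes_def by metis
  have uniq: "\<epsilon> = \<epsilon>'" if c: "codes \<rho> \<epsilon>" "codes \<rho> \<epsilon>'" for \<rho> \<epsilon> \<epsilon>'
  proof -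
    obtain p q :: int where e: "admissible \<epsilon>" "future \<epsilon> 0 = coord z l (v + real_vector \<rho>) + (p + q * l)"
      "past \<epsilon> 0 = - coord z lc (v + real_vector \<rho>) - (p + q * lc)" using c(1) unfolding codes_def by blast
    obtain p' q' :: int where e': "admissible \<epsilon>'" "future \<epsilon>' 0 = coord z l (v + real_vector \<rho>) + (p' + q' * l)"
      "past \<epsilon>' 0 = - coord z lc (v + real_vector \<rho>) - (p' + q' * lc)" using c(2) unfolding codes_def by blast
    show ?thesis
    proof (rule code_unique[OF e(1) e'(1)])
      show "generic (future \<epsilon> 0)" "generic (past \<epsilon> 0)"
        unfolding e by (intro generic_add generic_diff_conj gen)+
      show "future \<epsilon>' 0 = future \<epsilon> 0 + (of_int (p' - p) + of_int (q' - q) * l)"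
        "past \<epsilon>' 0 = past \<epsilon> 0 - (of_int (p' - p) + of_int (q' - q) * lc)"
        unfolding e e' by (simp_all add: algebra_simps)
    qed
  qed
  have comb: "real_vector (m *s z + n *s (M *v z)) = (m + n * l) *\<^sub>R ?u + (m + n * lc) *\<^sub>R ?s" for m n
  proof -
    have "real_vector (m *s z + n *s (M *v z)) = m *\<^sub>R real_vector z + n *\<^sub>R act (real_vector z)"
      by (simp add: vec_eq_iff act_real_vector)
    also have "\<dots> = m *\<^sub>R (?u + ?s) + n *\<^sub>R (Pu (act (real_vector z)) + Ps (act (real_vector z)))"
      by (simp add: Pu_add_Ps)
    finally show ?thesis by (simp add: Pu_act Ps_act algebra_simps)
  qed
  \<comment> \<open>In eigencoordinates, translating by \<open>m z + n Mz\<close> means adding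
    \<open>m + n * l\<close> and its conjugate.\<close>
  have codes_iff: "codes \<rho> \<epsilon> \<longleftrightarrow> admissible \<epsilon> \<and>
    (\<exists>m n. future \<epsilon> 0 *\<^sub>R ?u - past \<epsilon> 0 *\<^sub>R ?s = v + real_vector (\<rho> + m *s z + n *s (M *v z)))" for \<rho> \<epsilon>
  proof -
    have "future \<epsilon> 0 *\<^sub>R ?u - past \<epsilon> 0 *\<^sub>R ?s = v + real_vector (\<rho> + m *s z + n *s (M *v z)) \<longleftrightarrow>
      future \<epsilon> 0 = coord z l (v + real_vector \<rho>) + (m + n * l) \<and>
      past \<epsilon> 0 = - coord z lc (v + real_vector \<rho>) - (m + n * lc)" (is "?L \<longleftrightarrow> ?R") for m n
    proof -
      have rv: "v + real_vector (\<rho> + m *s z + n *s (M *v z)) = (v + real_vector \<rho>) + real_vector (m *s z + n *s (M *v z))"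
        by (simp add: vec_eq_iff)
      have expand: "v + real_vector (\<rho> + m *s z + n *s (M *v z)) =
          (coord z l (v + real_vector \<rho>) + (m + n * l)) *\<^sub>R ?u + (coord z lc (v + real_vector \<rho>) + (m + n * lc)) *\<^sub>R ?s"
        unfolding rv comb
        by (subst (1) coord_expand[OF z, of "v + real_vector \<rho>"]) (simp add: algebra_simps)
      show ?thesis
      proof
        assume L: ?L
        note L' = L[unfolded expand]
        from arg_cong[OF L', of "coord z l"] arg_cong[OF L', of "coord z lc"] show ?R
          by (simp add: coord_linear coord_Pu_Ps[OF z])
      next
        assume R: ?R
        show ?L unfolding expand conjunct1[OF R] conjunct2[OF R]
          by (simp add: scaleR_diff_left scaleR_add_left)
      qed
    qed
    then show ?thesis unfolding codes_def by simp
  qed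
  define f where "f \<rho> = (SOME \<epsilon>. codes \<rho> \<epsilon>)" for \<rho>
  have f: "codes \<rho> (f \<rho>)" for \<rho> unfolding f_def using ex by (rule someI_ex)
  have "bij_betw f R {\<epsilon>. admissible \<epsilon> \<and> code z \<epsilon> = torus_of v}"
  proof (rule bij_betwI')
    fix \<rho> \<rho>' assume mem: "\<rho> \<in> R" "\<rho>' \<in> R"
    show "f \<rho> = f \<rho>' \<longleftrightarrow> \<rho> = \<rho>'"
    proof
      assume eq: "f \<rho> = f \<rho>'"
      obtain m n where 1: "future (f \<rho>) 0 *\<^sub>R ?u - past (f \<rho>) 0 *\<^sub>R ?s = v + real_vector (\<rho> + m *s z + n *s (M *v z))"
        using f[of \<rho>] unfolding codes_iff by blast
      obtain m' n' where 2: "future (f \<rho>) 0 *\<^sub>R ?u - past (f \<rho>) 0 *\<^sub>R ?s = v + real_vector (\<rho>' + m' *s z + n' *s (M *v z))"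
        using f[of \<rho>'] unfolding codes_iff eq by blast
      have "v + real_vector (\<rho> + m *s z + n *s (M *v z)) = v + real_vector (\<rho>' + m' *s z + n' *s (M *v z))"
        using 1 2 by simp
      then have "real_vector (\<rho> + m *s z + n *s (M *v z)) = real_vector (\<rho>' + m' *s z + n' *s (M *v z))"
        by (rule add_left_imp_eq)
      then have "\<rho> + m *s z + n *s (M *v z) = \<rho>' + m' *s z + n' *s (M *v z)"
        by (rule real_vector_inject[THEN iffD1])
      then show "\<rho> = \<rho>'" using R(3)[of "\<rho> + m *s z + n *s (M *v z)"] mem by blast
    qed simp
  next
    fix \<rho> assume "\<rho> \<in> R"
    show "f \<rho> \<in> {\<epsilon>. admissible \<epsilon> \<and> code z \<epsilon> = torus_of v}"
      using f[of \<rho>] unfolding codes_iff code_def by (auto simp only: torus_of_add_int mem_Collect_eq)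
  next
    fix \<epsilon> assume "\<epsilon> \<in> {\<epsilon>. admissible \<epsilon> \<and> code z \<epsilon> = torus_of v}"
    then have \<epsilon>: "admissible \<epsilon>" "torus_of (future \<epsilon> 0 *\<^sub>R ?u - past \<epsilon> 0 *\<^sub>R ?s) = torus_of v"
      by (simp_all add: code_def)
    from torus_of_eq_obtain[OF this(2)] obtain w
      where w: "future \<epsilon> 0 *\<^sub>R ?u - past \<epsilon> 0 *\<^sub>R ?s = v + real_vector w" .
    obtain \<rho> m n where \<rho>: "\<rho> \<in> R" "w = \<rho> + m *s z + n *s (M *v z)"
      using R(3)[of w] by blast
    then have "codes \<rho> \<epsilon>" unfolding codes_iff using \<epsilon>(1) w by blast
    then show "\<exists>\<rho>\<in>R. \<epsilon> = f \<rho>" using uniq f \<rho>(1) by blast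
  qed
  then show "finite {\<epsilon>. admissible \<epsilon> \<and> code z \<epsilon> = torus_of v}"
    "card {\<epsilon>. admissible \<epsilon> \<and> code z \<epsilon> = torus_of v} = nat \<bar>index z\<bar>"
    using R bij_betw_finite bij_betw_same_card by metis+
qed

lemma AE_card_preimage:
  assumes "z \<noteq> 0" "is_coding_by M (Pu (real_vector z)) \<phi>"
  shows "AE p in torus_lebesgue. finite {\<epsilon> \<in> compactum M. \<phi> \<epsilon> = p} \<and>
    card {\<epsilon> \<in> compactum M. \<phi> \<epsilon> = p} = nat \<bar>index z\<bar>"
  using AE_regular[OF assms(1)]
proof eventually_elim
  case (elim p)
  then obtain v where v: "p = torus_of v" "regular z v" by blast
  have "{\<epsilon> \<in> compactum M. \<phi> \<epsilon> = p} = {\<epsilon>. admissible \<epsilon> \<and> code z \<epsilon> = torus_of v}"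
    using is_coding_by_imp_code[OF assms(2)] by (auto simp: compactum_eq v(1))
  then show ?case using card_code_preimage[OF assms(1) v(2)] by simp
qed

text \<open>The degree is determined uniquely because two almost everywhere statements must meet at
  some point.\<close>

lemma K_to_1_ae_iff:
  assumes "z \<noteq> 0" "is_coding_by M (Pu (real_vector z)) \<phi>"
  shows "K_to_1_ae M K \<phi> \<longleftrightarrow> K = nat \<bar>index z\<bar>"
proof
  assume "K_to_1_ae M K \<phi>"
  then have "AE p in torus_lebesgue. card {\<epsilon> \<in> compactum M. \<phi> \<epsilon> = p} = K"
    unfolding K_to_1_ae_def by simp
  then have "AE p in torus_lebesgue. K = nat \<bar>index z\<bar>"
    using AE_card_preimage[OF assms] by eventually_elim simp
  then show "K = nat \<bar>index z\<bar>" using AE_torus_lebesgue_ex by blast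
next
  assume "K = nat \<bar>index z\<bar>"
  then show "K_to_1_ae M K \<phi>"
    unfolding K_to_1_ae_def using AE_card_preimage[OF assms] index_nonzero[OF assms(1)] by auto
qed

subsection \<open>Minimal codings and basis solutions\<close>

text \<open>The rotation by a right angle conjugates the right action of \<open>M\<close> on row vectors to the
  action of the adjugate on column vectors.\<close>

definition rot :: "int^2 \<Rightarrow> int^2" where "rot v = vector [- (v$2), v$1]"

lemma rot_nth [simp]: "rot v $ 1 = - (v$2)" "rot v $ 2 = v$1"
  by (simp_all add: rot_def)

lemma rot_minus: "rot (- v) = - rot v"
  by (simp add: vec_eq_iff forall_2)

lemma rot_eq_0_iff [simp]: "rot v = 0 \<longleftrightarrow> v = 0"
  by (auto simp: vec_eq_iff forall_2)

lemma rot_surj: obtains v where "z = rot v"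
proof
  show "z = rot (vector [z$2, - (z$1)])" by (simp add: vec_eq_iff forall_2)
qed

text \<open>Here the quadratic form enters: up to sign its value is the degree of the coding by
  \<open>Pu (rot v)\<close>.\<close>

lemma index_rot: "index (rot v) = - qform M v"
  by (simp add: index_def det2_def mult_nth qform_def power2_eq_square algebra_simps)

lemma rot_vector_matrix_mult: "rot (v v* M) = trace M *s rot v - M *v rot v"
  by (simp add: vec_eq_iff forall_2 vector_matrix_mult_def sum_2 mult_nth trace_det algebra_simps)

text \<open>The adjugate \<open>trace M - M\<close> has eigenvalue \<open>trace M - l = lc\<close>
  on the expanding line. So the row action of \<open>M\<close> changes the homoclinic point only by
  a sign and a power of \<open>l\<close>.\<close>

lemma Pu_rot_step: "Pu (real_vector (rot (v v* M))) = lc *\<^sub>R Pu (real_vector (rot v))"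
proof -
  have eq: "real_vector (rot (v v* M)) = trace M *\<^sub>R real_vector (rot v) - act (real_vector (rot v))"
    unfolding rot_vector_matrix_mult act_real_vector by (simp add: vec_eq_iff)
  show ?thesis unfolding eq lc_eq by (simp add: Pu_linear Pu_act algebra_simps)
qed

lemma matpow_Suc: "matpow A (Suc n) = A ** matpow A n"
  by (simp add: matpow_def)

lemma Pu_rot_matpow:
  fixes A :: "int^2^2"
  assumes "\<And>v. Pu (real_vector (rot (v v* A))) = c *\<^sub>R Pu (real_vector (rot v))"
  shows "Pu (real_vector (rot (v v* matpow A n))) = c ^ n *\<^sub>R Pu (real_vector (rot v))"
proof (induction n arbitrary: v)
  case 0
  show ?case by (simp add: matpow_def)
next
  case (Suc n)
  have "Pu (real_vector (rot (v v* matpow A (Suc n)))) = c ^ n *\<^sub>R Pu (real_vector (rot (v v* A)))"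
    unfolding matpow_Suc vector_matrix_mul_assoc[symmetric] by (rule Suc)
  then show ?case by (simp add: assms mult.commute)
qed

lemma matrix_inv_mult: "matrix_inv M ** M = mat 1"
proof -
  have "\<exists>B. M ** B = mat 1 \<and> B ** M = mat 1" using invertible by (auto simp: invertible_def)
  then have "M ** matrix_inv M = mat 1 \<and> matrix_inv M ** M = mat 1"
    unfolding matrix_inv_def by (rule someI_ex)
  then show ?thesis ..
qed

lemma Pu_rot_matpowi: "Pu (real_vector (rot (v v* matpowi M n))) = lc powi n *\<^sub>R Pu (real_vector (rot v))"
proof (cases "0 \<le> n")
  case True
  then show ?thesis using Pu_rot_matpow[OF Pu_rot_step] by (simp add: matpowi_def power_int_def)
next
  case False
  have inv: "Pu (real_vector (rot (v v* matrix_inv M))) = inverse lc *\<^sub>R Pu (real_vector (rot v))" for v :: "int^2"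
  proof -
    have "Pu (real_vector (rot v)) = lc *\<^sub>R Pu (real_vector (rot (v v* matrix_inv M)))"
      using Pu_rot_step[of "v v* matrix_inv M"] by (simp add: vector_matrix_mul_assoc matrix_inv_mult)
    then show ?thesis using lc_nonzero by simp
  qed
  show ?thesis using False Pu_rot_matpow[OF inv] by (simp add: matpowi_def power_int_def)
qed

lemma lc_powi: "\<exists>\<delta>\<in>{1, -1}. lc powi n = \<delta> * l powi (- n)"
proof -
  have "lc = \<sigma> * inverse l" if "\<sigma> = det M" for \<sigma> :: int
    using inverse_l that by (simp add: divide_inverse flip: mult.assoc)
  then have "lc powi n = of_int (det M) powi n * l powi (- n)"
    by (simp add: power_int_mult_distrib power_int_minus power_int_inverse)
  moreover have "(-1 :: real) powi n \<in> {1, -1}"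
    by (cases "even n") (auto simp: power_int_minus_left)
  ultimately show ?thesis using sigma_cases by auto
qed

text \<open>For \<open>u = rot v\<close> the vector is \<open>u - \<sigma> l Mu\<close> divided by
  \<open>l - lc\<close>, with \<open>\<sigma> = det M\<close>. Factoring out
  \<open>- \<sigma> l\<close> leaves \<open>Mu - lc u\<close>, because
  \<open>\<sigma> l lc = 1\<close>.\<close>

lemma homoclinic_vec_eq:
  "homoclinic_vec M (v$1) (- (v$2)) = (- (det M * l)) *\<^sub>R Pu (real_vector (rot v))"
proof -
  have D: "sqrt (of_int (discr M)) = l - lc" by (simp add: l_diff discr_def)
  let ?z = "real_vector (rot v)"
  have "homoclinic_vec M (v$1) (- (v$2)) = (1 / (l - lc)) *\<^sub>R (?z - (det M * l) *\<^sub>R act ?z)"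
    unfolding act_real_vector
    by (simp add: homoclinic_vec_def Let_def D lam_eq rot_def[symmetric] vec_eq_iff forall_2
        diff_divide_distrib add_divide_distrib algebra_simps)
  also have "?z - (det M * l) *\<^sub>R act ?z = (- (det M * l)) *\<^sub>R (act ?z - lc *\<^sub>R ?z)"
  proof -
    have "(det M * l) *\<^sub>R (lc *\<^sub>R ?z) = ?z" by (simp add: l_mult mult.assoc)
    then show ?thesis by (simp add: scaleR_diff_right)
  qed
  finally show ?thesis by (simp add: Pu_def)
qed

lemma homoclinic_lift_homoclinic_vec:
  fixes v :: "int^2"
  assumes "v \<noteq> 0"
  shows "homoclinic_lift M (homoclinic_vec M (v$1) (- (v$2)))"
proof -
  have "homoclinic_vec M (v$1) (- (v$2)) = Pu (real_vector (- (det M *s (M *v rot v))))"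
  proof -
    have eq: "real_vector (- (det M *s (M *v rot v))) = (- det M) *\<^sub>R act (real_vector (rot v))"
      unfolding act_real_vector by (simp add: vec_eq_iff)
    show ?thesis unfolding homoclinic_vec_eq eq Pu_linear Pu_act by simp
  qed
  moreover have "- (det M *s (M *v rot v)) \<noteq> 0"
  proof
    assume "- (det M *s (M *v rot v)) = 0"
    then have "M *v rot v = 0" using sigma_cases by (auto simp: vec_eq_iff)
    then have "index (rot v) = 0" by (simp add: index_def det2_def)
    then show False using index_nonzero[of "rot v"] assms by simp
  qed
  ultimately show ?thesis using homoclinic_lift_Pu by metis
qed

lemma form_min_le:
  assumes "v \<noteq> 0" shows "form_min M \<le> \<bar>qform M v\<bar>"
proof -
  have "(LEAST k. \<exists>v. v \<noteq> 0 \<and> k = nat \<bar>qform M v\<bar>) \<le> nat \<bar>qform M v\<bar>"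
    using assms by (intro Least_le) blast
  then show ?thesis unfolding form_min_def by linarith
qed

lemma form_min_attained: obtains v where "v \<noteq> 0" "\<bar>qform M v\<bar> = form_min M"
proof -
  have "\<exists>k. \<exists>v. v \<noteq> 0 \<and> k = nat \<bar>qform M v\<bar>"
    by (intro exI[of _ "nat \<bar>qform M (vector [1, 0])\<bar>"] exI[of _ "vector [1, 0]"] conjI refl) (simp add: vec_eq_iff forall_2)
  from LeastI_ex[OF this] obtain v where "v \<noteq> 0" "nat \<bar>qform M v\<bar> = (LEAST k. \<exists>v. v \<noteq> 0 \<and> k = nat \<bar>qform M v\<bar>)"
    by metis
  then show ?thesis using that[of v] unfolding form_min_def by linarith
qed

lemma is_solution_nonzero:
  assumes "is_solution M v" shows "v \<noteq> 0"
proof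
  assume "v = 0"
  obtain v' where "v' \<noteq> 0" "\<bar>qform M v'\<bar> = form_min M" by (rule form_min_attained)
  then have "form_min M \<noteq> 0" using index_rot[of v'] index_nonzero[of "rot v'"] by auto
  then show False using assms \<open>v = 0\<close> by (simp add: is_solution_def qform_def)
qed

text \<open>The degree of \<open>\<phi>\<close> is a value of the form; comparing it with the coding
  built from a minimizer \<open>v0\<close> bounds it by \<open>form_min M\<close>.\<close>

lemma minimal_coding_imp_solution:
  assumes "minimal_arithmetic_coding M \<phi>"
  obtains v where "is_solution M v" "is_coding_by M (Pu (real_vector (rot v))) \<phi>"
proof -
  obtain t K where t: "homoclinic_lift M t" "is_coding_by M t \<phi>" and K: "K_to_1_ae M K \<phi>"
    and min: "\<And>\<psi> L. arithmetic_coding M \<psi> \<Longrightarrow> K_to_1_ae M L \<psi> \<Longrightarrow> K \<le> L"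
    using assms unfolding minimal_arithmetic_coding_def arithmetic_coding_def[of M \<phi>] by blast
  obtain z where z: "z \<noteq> 0" "t = Pu (real_vector z)" using homoclinic_lift_imp_Pu[OF t(1)] by blast
  obtain v where v: "z = rot v" by (rule rot_surj)
  have "K = nat \<bar>qform M v\<bar>"
    using K_to_1_ae_iff[OF z(1), of \<phi> K] K t(2) z(2) by (simp add: v index_rot)
  moreover obtain v0 where v0: "v0 \<noteq> 0" "\<bar>qform M v0\<bar> = form_min M" by (rule form_min_attained)
  have "K_to_1_ae M (nat \<bar>qform M v0\<bar>) (code (rot v0))"
    using K_to_1_ae_iff[OF _ is_coding_by_code, of "rot v0"] v0(1) by (simp add: index_rot)
  moreover have "arithmetic_coding M (code (rot v0))"
    unfolding arithmetic_coding_def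
    using is_coding_by_code homoclinic_lift_Pu[of "rot v0"] v0(1) by auto
  ultimately have "\<bar>qform M v\<bar> \<le> form_min M" using min v0(2) by force
  moreover have "form_min M \<le> \<bar>qform M v\<bar>" using z(1) v by (intro form_min_le) auto
  ultimately have "is_solution M v" unfolding is_solution_def by linarith
  then show ?thesis using that t(2) z(2) v by blast
qed

end

theorem theorem3p5:
  fixes M :: "int^2^2" and s :: nat and w :: "nat \<Rightarrow> int^2"
    and \<phi> :: "(int \<Rightarrow> int) \<Rightarrow> torus"
  assumes "invertible M"
    and "hyperbolic_matrix M"
    and "primitive_matrix M"
    and "trace M > 0"
    and "basis_solutions M s w"
    and "minimal_arithmetic_coding M \<phi>"
  shows "(\<forall>j\<in>{1..s}. homoclinic_lift M (homoclinic_vec M (w j $ 1) (- (w j $ 2)))) \<and>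
         (\<exists>(k::int). \<exists>j\<in>{1..s}. \<exists>\<delta>\<in>{1, -1::real}.
           is_coding_by M
             ((\<delta> * lam M powi k) *\<^sub>R homoclinic_vec M (w j $ 1) (- (w j $ 2))) \<phi>)"
proof (intro conjI ballI)
  interpret toral_automorphism M using assms by unfold_locales
  fix j assume "j \<in> {1..s}"
  then have "is_solution M (w j)" using assms(5) by (simp add: basis_solutions_def)
  then show "homoclinic_lift M (homoclinic_vec M (w j $ 1) (- (w j $ 2)))"
    by (intro homoclinic_lift_homoclinic_vec is_solution_nonzero)
next
  interpret toral_automorphism M using assms by unfold_locales
  obtain v where v: "is_solution M v" "is_coding_by M (Pu (real_vector (rot v))) \<phi>"
    using minimal_coding_imp_solution[OF assms(6)] .
  have "\<exists>j\<in>{1..s}. \<exists>n. v = w j v* matpowi M n \<or> v = - (w j v* matpowi M n)"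
    using assms(5) v(1) unfolding basis_solutions_def by blast
  then obtain j n where j: "j \<in> {1..s}" "v = w j v* matpowi M n \<or> v = - (w j v* matpowi M n)"
    by blast
  let ?X = "Pu (real_vector (rot (w j)))" and ?h = "homoclinic_vec M (w j $ 1) (- (w j $ 2))"
  have neg: "Pu (real_vector (- z)) = - Pu (real_vector z)" for z
  proof -
    have eq: "real_vector (- z) = (-1) *\<^sub>R real_vector z" by (simp add: vec_eq_iff)
    show ?thesis unfolding eq Pu_linear by simp
  qed
  have "\<exists>\<delta>\<in>{1, -1}. Pu (real_vector (rot v)) = \<delta> *\<^sub>R Pu (real_vector (rot (w j v* matpowi M n)))"
    using j(2)
  proof
    assume v': "v = - (w j v* matpowi M n)"
    show ?thesis unfolding v' rot_minus neg by (intro bexI[of _ "-1"]) simp_all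
  qed auto
  then obtain \<delta> where \<delta>: "\<delta> \<in> {1, -1}" "Pu (real_vector (rot v)) = (\<delta> * lc powi n) *\<^sub>R ?X"
    unfolding Pu_rot_matpowi scaleR_scaleR by blast
  obtain \<delta>' where \<delta>': "\<delta>' \<in> {1, -1}" "lc powi n = \<delta>' * l powi (- n)" using lc_powi by blast
  have X: "?X = (- det M * l powi (-1)) *\<^sub>R ?h"
  proof -
    have "(- det M * l powi (-1)) * (- (det M * l)) = (det M * det M) * (inverse l * l)"
      by (simp add: power_int_minus)
    also have "\<dots> = 1" using l_pos by simp
    finally show ?thesis unfolding homoclinic_vec_eq scaleR_scaleR by simp
  qed
  \<comment> \<open>The exponent \<open>- n\<close> comes from \<open>lc powi n\<close>, the extra
    \<open>-1\<close> from the factor \<open>l\<close> in \<open>homoclinic_vec_eq\<close>.\<close>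
  have pw: "l powi (- n) * l powi (-1) = l powi (- n - 1)"
    using l_pos by (simp add: power_int_diff power_int_minus divide_inverse)
  have "Pu (real_vector (rot v)) = (\<delta> * \<delta>' * (- det M) * (l powi (- n) * l powi (-1))) *\<^sub>R ?h"
    unfolding \<delta>(2) \<delta>'(2) X by (simp add: mult_ac)
  then have "Pu (real_vector (rot v)) = ((\<delta> * \<delta>' * (- det M)) * lam M powi (- n - 1)) *\<^sub>R ?h"
    unfolding pw lam_eq .
  moreover have "\<delta> * \<delta>' * (- det M) \<in> {1, -1}" using \<delta>(1) \<delta>'(1) sigma_cases by auto
  ultimately show "\<exists>(k::int). \<exists>j\<in>{1..s}. \<exists>\<delta>\<in>{1, -1::real}.
      is_coding_by M ((\<delta> * lam M powi k) *\<^sub>R homoclinic_vec M (w j $ 1) (- (w j $ 2))) \<phi>"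
    using v(2) j(1) by metis
qed

end
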